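(* Let $\{f_k\}_{k=1}^\infty$ be a frame for $\ell^2(\mathbb N)$ with frame bounds $A,B$, consisting of finitely supported vectors; for $k\in\mathbb N$ let $m(k)$ denote the largest index of a nonzero coordinate of $f_k$. Fix $\lambda>1$ and let $T,U:\ell^2(\mathbb N)\to\ell^2(\mathbb N)$ be $$T(x_1,x_2,\dots)=\lambda(x_2,x_3,\dots),\qquad U(x_1,x_2,\dots)=\lambda^{-1}(0,x_1,x_2,\dots).$$ Let $\{\alpha(k)\}_{k=1}^\infty$ be a strictly increasing sequence of nonnegative integers such that $\alpha(1)=0$ and $\alpha(k+1)-\alpha(k)\ge m(k)$ for all $k\in\mathbb N$, and let $\varphi:=\sum_{n=1}^\infty U^{\alpha(n)}f_n$ (the series converges in $\ell^2(\mathbb N)$). Then for every $k\in\mathbb N$, $$\|f_k-T^{\alpha(k)}\varphi\|^2\le\frac{B\lambda^2}{\lambda^2-1}\,\lambda^{-2[\alpha(k+1)-\alpha(k)]}.$$ In particular, let $\epsilon\in\,]0,A[$ and choose nonnegative integers $\alpha(k)$ such that $\alpha(1)=0$ and, for all $k\in\mathbb N$, $$\alpha(k+1)-\alpha(k)\ge\max\left(m(k),\ \frac{k\ln 2+\ln\left(\frac B\epsilon\right)+\ln\left(\frac{\lambda^2}{\lambda^2-1}\right)}{2\ln\lambda}\right),$$ and, for this choice of the integers $\alpha(k)$, let $\varphi:=\sum_{n=1}^\infty U^{\alpha(n)}f_n$. Then $\|f_k-T^{\alpha(k)}\varphi\|^2\le\epsilon 2^{-k}$ for all $k\in\mathbb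 N$. Consequently, writing $\widetilde f_k:=T^{\alpha(k)}\varphi$, the following hold: (i) $\{\widetilde f_k\}_{k=1}^\infty$ is a frame for $\ell^2(\mathbb N)$ with bounds $A(1-\sqrt{\epsilon/A})^2$ and $B(1+\sqrt{\epsilon/B})^2$, and it has the same excess as $\{f_k\}_{k=1}^\infty$; (ii) with $V,\widetilde V$ the synthesis operators and $S,\widetilde S$ the frame operators of $\{f_k\}_{k=1}^\infty$ and $\{\widetilde f_k\}_{k=1}^\infty$, respectively, $$\|V-\widetilde V\|\le\sqrt\epsilon,\quad \|S-\widetilde S\|\le\sqrt{\epsilon B}\left(2+\sqrt{\tfrac{\epsilon}{B}}\right),\quad \|S^{-1}-\widetilde S^{-1}\|\le\frac{\sqrt{\epsilon B}\,(2+\sqrt{\epsilon/B})}{A^2(1-\sqrt{\epsilon/A})^2}.$$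
   Context: A sequence $\{f_k\}_{k=1}^\infty$ in a Hilbert space $\mathcal H$ is a frame with (lower, upper) frame bounds $A,B>0$ if $A\|f\|^2\le\sum_k|\langle f,f_k\rangle|^2\le B\|f\|^2$ for all $f\in\mathcal H$. Its synthesis operator is $V:\ell^2(\mathbb N)\to\mathcal H$, $V\{c_k\}=\sum_k c_kf_k$, and its frame operator is $S=VV^*$. The excess of a frame is the supremum (in $\mathbb N_0\cup\{\infty\}$) of the numbers $n$ such that some $n$ elements can be removed leaving a frame; equivalently, it is the dimension of the kernel of the synthesis operator (finite or $\infty$). Convention: $m(k)=0$ if $f_k=0$. *)

theory Defs
  imports "HOL-Analysis.Analysis"
begin

text \<open>
  The complex Hilbert space of square-summable sequences \<open>(x\<^sub>1, x\<^sub>2, \<dots>)\<close>.  Coordinates are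
  numbered from 1; the slot 0 of the representing function is unused and pinned to 0.
\<close>

typedef ell2 = "{x :: nat \<Rightarrow> complex. x 0 = 0 \<and> summable (\<lambda>n. (cmod (x n))\<^sup>2)}"
  morphisms coord Abs_ell2
  by (rule exI[of _ "\<lambda>_. 0"]) simp

setup_lifting type_definition_ell2

lemma coord_0_index [simp]: "coord x 0 = 0"
  using coord[of x] by simp

lemma summable_coord: "summable (\<lambda>n. (cmod (coord x n))\<^sup>2)"
  using coord[of x] by simp

lemma ell2_eqI: "(\<And>n. coord x n = coord y n) \<Longrightarrow> x = y"
  by (metis coord_inject ext)

lemma square_summable_add:
  fixes x y :: "nat \<Rightarrow> complex"
  assumes "summable (\<lambda>n. (cmod (x n))\<^sup>2)" "summable (\<lambda>n. (cmod (y n))\<^sup>2)"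
  shows "summable (\<lambda>n. (cmod (x n + y n))\<^sup>2)"
proof (rule summable_comparison_test'[where N = 0])
  show "summable (\<lambda>n. 2 * (cmod (x n))\<^sup>2 + 2 * (cmod (y n))\<^sup>2)"
    using assms by (intro summable_add summable_mult)
  fix n
  have "(cmod (x n + y n))\<^sup>2 \<le> (cmod (x n) + cmod (y n))\<^sup>2"
    by (intro power_mono norm_triangle_ineq) simp
  also have "\<dots> \<le> 2 * (cmod (x n))\<^sup>2 + 2 * (cmod (y n))\<^sup>2"
    using sum_squares_bound[of "cmod (x n)" "cmod (y n)"] by (simp add: power2_sum)
  finally show "norm ((cmod (x n + y n))\<^sup>2) \<le> 2 * (cmod (x n))\<^sup>2 + 2 * (cmod (y n))\<^sup>2"
    by simp
qed

lemma square_summable_mult: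
  fixes x :: "nat \<Rightarrow> complex"
  shows "summable (\<lambda>n. (cmod (x n))\<^sup>2) \<Longrightarrow> summable (\<lambda>n. (cmod (a * x n))\<^sup>2)"
  by (simp add: norm_mult power_mult_distrib summable_mult)

lemma summable_coord_prod: "summable (\<lambda>n. coord x n * cnj (coord y n))"
proof (rule summable_comparison_test'[where N = 0])
  show "summable (\<lambda>n. (cmod (coord x n))\<^sup>2 + (cmod (coord y n))\<^sup>2)"
    by (intro summable_add summable_coord)
  fix n
  have "0 \<le> cmod (coord x n) * cmod (coord y n)" by simp
  then show "norm (coord x n * cnj (coord y n)) \<le> (cmod (coord x n))\<^sup>2 + (cmod (coord y n))\<^sup>2"
    using sum_squares_bound[of "cmod (coord x n)" "cmod (coord y n)"]
    unfolding norm_mult complex_mod_cnj by linarith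
qed

lift_definition scaleC_ell2 :: "complex \<Rightarrow> ell2 \<Rightarrow> ell2"  (infixr "*\<^sub>C" 75)
  is "\<lambda>a x n. a * x n"
  by (simp add: square_summable_mult)

text \<open>The inner product is linear in its first argument.\<close>

definition cinner :: "ell2 \<Rightarrow> ell2 \<Rightarrow> complex"
  where "cinner x y = (\<Sum>n. coord x n * cnj (coord y n))"

instantiation ell2 :: real_inner
begin

lift_definition zero_ell2 :: ell2 is "\<lambda>_. 0" by simp

lift_definition plus_ell2 :: "ell2 \<Rightarrow> ell2 \<Rightarrow> ell2" is "\<lambda>x y n. x n + y n"
  by (simp add: square_summable_add)

lift_definition uminus_ell2 :: "ell2 \<Rightarrow> ell2" is "\<lambda>x n. - x n" by simp

definition minus_ell2 :: "ell2 \<Rightarrow> ell2 \<Rightarrow> ell2" where "minus_ell2 x y = x + - y"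

definition scaleR_ell2 :: "real \<Rightarrow> ell2 \<Rightarrow> ell2"
  where "scaleR_ell2 r x = complex_of_real r *\<^sub>C x"

definition inner_ell2 :: "ell2 \<Rightarrow> ell2 \<Rightarrow> real" where "inner_ell2 x y = Re (cinner x y)"

definition norm_ell2 :: "ell2 \<Rightarrow> real"
  where "norm_ell2 x = sqrt (\<Sum>n. (cmod (coord x n))\<^sup>2)"

definition dist_ell2 :: "ell2 \<Rightarrow> ell2 \<Rightarrow> real" where "dist_ell2 x y = norm (x - y)"

definition sgn_ell2 :: "ell2 \<Rightarrow> ell2" where "sgn_ell2 x = inverse (norm x) *\<^sub>R x"

definition uniformity_ell2 :: "(ell2 \<times> ell2) filter"
  where "uniformity_ell2 = (INF e\<in>{0<..}. principal {(x, y). dist x y < e})"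

definition open_ell2 :: "ell2 set \<Rightarrow> bool"
  where "open_ell2 U \<longleftrightarrow> (\<forall>x\<in>U. eventually (\<lambda>(x', y). x' = x \<longrightarrow> y \<in> U) uniformity)"

instance
proof
  fix x y z :: ell2 and r s :: real
  note [simp] = zero_ell2.rep_eq plus_ell2.rep_eq uminus_ell2.rep_eq scaleC_ell2.rep_eq
  have inner_sums: "(\<lambda>n. Re (coord u n * cnj (coord v n))) sums inner u v" for u v :: ell2
    unfolding inner_ell2_def cinner_def
    by (rule sums_Re[OF summable_sums[OF summable_coord_prod]])
  have self: "Re (w * cnj w) = (cmod w)\<^sup>2" for w
    unfolding cmod_power2 by (simp add: power2_eq_square)
  have inner_self: "inner x x = (\<Sum>n. (cmod (coord x n))\<^sup>2)"
    using inner_sums[of x x] unfolding self by (simp add: sums_iff)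
  show "x + y + z = x + (y + z)" "x + y = y + x" "0 + x = x" "- x + x = 0"
    by (rule ell2_eqI; simp)+
  show "x - y = x + - y" by (fact minus_ell2_def)
  show "r *\<^sub>R (x + y) = r *\<^sub>R x + r *\<^sub>R y" "(r + s) *\<^sub>R x = r *\<^sub>R x + s *\<^sub>R x"
    "r *\<^sub>R s *\<^sub>R x = (r * s) *\<^sub>R x" "1 *\<^sub>R x = x"
    by (rule ell2_eqI; simp add: scaleR_ell2_def algebra_simps)+
  show "dist x y = norm (x - y)" by (fact dist_ell2_def)
  show "sgn x = inverse (norm x) *\<^sub>R x" by (fact sgn_ell2_def)
  show "(uniformity :: (ell2 \<times> ell2) filter) = (INF e\<in>{0<..}. principal {(x, y). dist x y < e})"
    by (fact uniformity_ell2_def)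
  show "open U = (\<forall>x\<in>U. \<forall>\<^sub>F (x', y) in uniformity. x' = x \<longrightarrow> y \<in> U)" for U :: "ell2 set"
    by (fact open_ell2_def)
  have "Re (coord x n * cnj (coord y n)) = Re (coord y n * cnj (coord x n))" for n
    by simp
  then show "inner x y = inner y x"
    using inner_sums[of x y] inner_sums[of y x] by (metis (no_types, lifting) ext sums_unique2)
  show "inner (x + y) z = inner x z + inner y z"
    using sums_add[OF inner_sums[of x z] inner_sums[of y z]] inner_sums[of "x + y" z]
    by (simp add: sums_iff algebra_simps)
  show "inner (r *\<^sub>R x) y = r * inner x y"
    using sums_mult[OF inner_sums[of x y], of r] inner_sums[of "r *\<^sub>R x" y]
    by (simp add: sums_iff scaleR_ell2_def algebra_simps)
  show "0 \<le> inner x x" unfolding inner_self by (simp add: suminf_nonneg summable_coord)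
  show "(inner x x = 0) = (x = 0)"
  proof
    assume "inner x x = 0"
    then have "\<forall>n. (cmod (coord x n))\<^sup>2 = 0"
      unfolding inner_self by (subst (asm) suminf_eq_zero_iff) (auto simp: summable_coord)
    then show "x = 0" by (intro ell2_eqI) simp
  qed (simp add: inner_ell2_def cinner_def)
  show "norm x = sqrt (inner x x)" unfolding inner_self by (fact norm_ell2_def)
qed

end

definition finitely_supported :: "ell2 \<Rightarrow> bool"
  where "finitely_supported x \<longleftrightarrow> finite {n. coord x n \<noteq> 0}"

text \<open>Meaningful for finitely supported \<open>x\<close>; the value at the zero vector is a convention.\<close>

definition max_index :: "ell2 \<Rightarrow> nat"
  where "max_index x = (if x = 0 then 0 else Max {n. coord x n \<noteq> 0})"

lemma left_shift_mem:
  assumes "summable (\<lambda>n. (cmod (x n))\<^sup>2)"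
  shows "summable (\<lambda>n. (cmod (if n = 0 then 0 else complex_of_real l * x (n + 1)))\<^sup>2)"
proof -
  have "summable (\<lambda>n. (cmod (complex_of_real l * x (n + 2)))\<^sup>2)"
    using summable_ignore_initial_segment[OF square_summable_mult[OF assms], of _ 2] by simp
  then show ?thesis by (subst summable_Suc_iff[symmetric]) (simp add: numeral_2_eq_2)
qed

lemma right_shift_mem:
  assumes "summable (\<lambda>n. (cmod (x n))\<^sup>2)"
  shows "summable (\<lambda>n. (cmod (if n \<le> 1 then 0 else complex_of_real l * x (n - 1)))\<^sup>2)"
proof -
  have "summable (\<lambda>n. (cmod (complex_of_real l * x (n + 1)))\<^sup>2)"
    using summable_ignore_initial_segment[OF square_summable_mult[OF assms], of _ 1] by simp
  then show ?thesis
    by (subst summable_iff_shift[of _ 2, symmetric]) simp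
qed

lift_definition shift_T :: "real \<Rightarrow> ell2 \<Rightarrow> ell2"
  is "\<lambda>l x n. if n = 0 then 0 else complex_of_real l * x (n + 1)"
  using left_shift_mem by simp

lift_definition shift_U :: "real \<Rightarrow> ell2 \<Rightarrow> ell2"
  is "\<lambda>l x n. if n \<le> 1 then 0 else complex_of_real (inverse l) * x (n - 1)"
  using right_shift_mem by simp

text \<open>
  A family over an index set \<open>I\<close>, so that removing elements is shrinking \<open>I\<close>.  A sequence
  \<open>(f\<^sub>k)\<close> with \<open>k = 1, 2, \<dots>\<close> is the family over \<open>{1..}\<close>; the value \<open>f 0\<close> never matters.
\<close>

definition frame_on :: "nat set \<Rightarrow> (nat \<Rightarrow> ell2) \<Rightarrow> real \<Rightarrow> real \<Rightarrow> bool"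
  where "frame_on I f A B \<longleftrightarrow> 0 < A \<and> 0 < B \<and>
    (\<forall>g. (\<lambda>k. (cmod (cinner g (f k)))\<^sup>2) summable_on I \<and>
         A * (norm g)\<^sup>2 \<le> (\<Sum>\<^sub>\<infinity>k\<in>I. (cmod (cinner g (f k)))\<^sup>2) \<and>
         (\<Sum>\<^sub>\<infinity>k\<in>I. (cmod (cinner g (f k)))\<^sup>2) \<le> B * (norm g)\<^sup>2)"

definition excess :: "(nat \<Rightarrow> ell2) \<Rightarrow> enat"
  where "excess f =
    Sup {enat (card J) | J. finite J \<and> J \<subseteq> {1..} \<and> (\<exists>A B. frame_on ({1..} - J) f A B)}"

definition synthesis :: "(nat \<Rightarrow> ell2) \<Rightarrow> ell2 \<Rightarrow> ell2"
  where "synthesis f c = (\<Sum>k. coord c (Suc k) *\<^sub>C f (Suc k))"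

definition cadjoint :: "(ell2 \<Rightarrow> ell2) \<Rightarrow> ell2 \<Rightarrow> ell2"
  where "cadjoint V = (THE W. \<forall>x y. cinner (V x) y = cinner x (W y))"

definition frame_operator :: "(nat \<Rightarrow> ell2) \<Rightarrow> ell2 \<Rightarrow> ell2"
  where "frame_operator f = synthesis f \<circ> cadjoint (synthesis f)"

end

theory Submission
  imports Defs
begin

text \<open>
  The backward shift \<open>T\<close> undoes \<open>U\<close> and annihilates the blocks before the \<open>k\<close>-th one, so that
  \<open>T\<^bsup>\<alpha>(k)\<^esup>\<phi> - f\<^sub>k\<close> is the sum of the later blocks \<open>U\<^bsup>\<alpha>(n)-\<alpha>(k)\<^esup>f\<^sub>n\<close>, \<open>n > k\<close>.  These have disjoint supports,
  and Pythagoras reduces the estimate to a geometric series.  Summing over \<open>k\<close>, the differences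
  \<open>d\<^sub>k = f\<^sub>k - T\<^bsup>\<alpha>(k)\<^esup>\<phi>\<close> form a Bessel sequence with bound \<open>\<epsilon> < A\<close>, which gives the frame bounds and
  the operator estimates.

  For the excess, let \<open>C = V\<^sup>*\<close>.  Both \<open>V C\<close> and \<open>V' C\<close> are coercive, hence bijective, so the kernels of
  \<open>V\<close> and \<open>V'\<close> are both complements of the range of \<open>C\<close>.  A finite set \<open>J\<close> is removable iff the kernel
  of the synthesis operator restricts onto the coordinates in \<open>J\<close>; by elimination such a \<open>J\<close> of size \<open>n\<close>
  exists as soon as the kernel contains \<open>n\<close> linearly independent vectors.
\<close>

subsection \<open>The Hilbert space of square-summable sequences\<close>

lemmas coord_simps [simp] =
  zero_ell2.rep_eq plus_ell2.rep_eq uminus_ell2.rep_eq scaleC_ell2.rep_eq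

lemma coord_diff [simp]: "coord (x - y) n = coord x n - coord y n"
  by (simp only: minus_ell2_def coord_simps) simp

lemma coord_scaleR [simp]: "coord (r *\<^sub>R x) n = complex_of_real r * coord x n"
  by (simp add: scaleR_ell2_def)

lemma coord_sum [simp]: "coord (sum g I) n = (\<Sum>i\<in>I. coord (g i) n)"
  by (induction I rule: infinite_finite_induct) auto

lemma norm_ell2_sums: "(\<lambda>n. (cmod (coord x n))\<^sup>2) sums (norm x)\<^sup>2"
  unfolding norm_ell2_def
  using summable_sums[OF summable_coord[of x]]
  by (simp add: suminf_nonneg summable_coord)

lemma norm_ell2_sums_Suc: "(\<lambda>n. (cmod (coord x (Suc n)))\<^sup>2) sums (norm x)\<^sup>2"
  using norm_ell2_sums[of x] by (subst sums_Suc_iff) simp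

lemma sum_coord_le_norm: "finite F \<Longrightarrow> (\<Sum>n\<in>F. (cmod (coord x n))\<^sup>2) \<le> (norm x)\<^sup>2"
  using norm_ell2_sums[of x] sum_le_suminf[of "\<lambda>n. (cmod (coord x n))\<^sup>2" F]
  by (auto simp: sums_iff)

lemma norm_coord_le: "cmod (coord x n) \<le> norm x"
  using sum_coord_le_norm[of "{n}" x] by (simp add: power2_le_iff_abs_le)

lemma norm_ell2_le:
  assumes "0 \<le> b" "\<And>N. (\<Sum>n<N. (cmod (coord x n))\<^sup>2) \<le> b\<^sup>2"
  shows "norm x \<le> b"
proof -
  have "(norm x)\<^sup>2 \<le> b\<^sup>2"
    using norm_ell2_sums[of x] assms(2) unfolding sums_def
    by (intro LIMSEQ_le_const2) auto
  then show ?thesis using assms(1) power2_le_imp_le by blast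
qed

lemma norm_scaleC [simp]: "norm (a *\<^sub>C x) = cmod a * norm x"
proof -
  have "(\<lambda>n. (cmod (coord (a *\<^sub>C x) n))\<^sup>2) sums ((cmod a)\<^sup>2 * (norm x)\<^sup>2)"
    using sums_mult[OF norm_ell2_sums[of x], of "(cmod a)\<^sup>2"]
    by (simp add: norm_mult power_mult_distrib)
  from sums_unique2[OF norm_ell2_sums this]
  have "(norm (a *\<^sub>C x))\<^sup>2 = (cmod a * norm x)\<^sup>2"
    by (simp only: power_mult_distrib)
  then show ?thesis by (simp add: power2_eq_iff_nonneg)
qed

lemma scaleC_add_right: "a *\<^sub>C (x + y) = a *\<^sub>C x + a *\<^sub>C y"
  by (rule ell2_eqI) (simp add: algebra_simps)

lemma scaleC_add_left: "(a + b) *\<^sub>C x = a *\<^sub>C x + b *\<^sub>C x"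
  by (rule ell2_eqI) (simp add: algebra_simps)

lemma scaleC_diff_right: "a *\<^sub>C (x - y) = a *\<^sub>C x - a *\<^sub>C y"
  by (rule ell2_eqI) (simp add: algebra_simps)

lemma scaleC_scaleC [simp]: "a *\<^sub>C b *\<^sub>C x = (a * b) *\<^sub>C x"
  by (rule ell2_eqI) (simp add: algebra_simps)

lemma scaleC_zero [simp]: "a *\<^sub>C 0 = 0" "0 *\<^sub>C x = 0" and scaleC_one [simp]: "1 *\<^sub>C x = x"
  by (rule ell2_eqI; simp)+

lemma scaleR_scaleC_commute: "r *\<^sub>R a *\<^sub>C x = a *\<^sub>C r *\<^sub>R x"
  by (rule ell2_eqI) (simp add: algebra_simps)

lemma bounded_linear_scaleC: "bounded_linear (\<lambda>x. a *\<^sub>C x)"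
  by (rule bounded_linear_intro[where K = "cmod a"])
     (auto simp: scaleC_add_right scaleR_scaleC_commute mult.commute)

lemma bounded_linear_coord: "bounded_linear (\<lambda>x. coord x n)"
  by (rule bounded_linear_intro[where K = 1]) (auto simp: norm_coord_le scaleR_conv_of_real)

section \<open>The complex inner product\<close>

lemma cinner_sums: "(\<lambda>n. coord x n * cnj (coord y n)) sums cinner x y"
  unfolding cinner_def by (rule summable_sums[OF summable_coord_prod])

lemma cinner_commute: "cinner y x = cnj (cinner x y)"
proof -
  have "(\<lambda>n. cnj (coord x n * cnj (coord y n))) sums cnj (cinner x y)"
    using cinner_sums[of x y] by (simp only: sums_cnj)
  then show ?thesis using cinner_sums[of y x] by (simp add: mult.commute sums_iff)
qed

lemma cinner_add_left: "cinner (x + y) z = cinner x z + cinner y z"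
  using sums_add[OF cinner_sums[of x z] cinner_sums[of y z]] cinner_sums[of "x + y" z]
  by (simp add: sums_iff algebra_simps)

lemma cinner_scaleC_left: "cinner (a *\<^sub>C x) y = a * cinner x y"
  using sums_mult[OF cinner_sums[of x y], of a] cinner_sums[of "a *\<^sub>C x" y]
  by (simp add: sums_iff algebra_simps)

lemma cinner_add_right: "cinner z (x + y) = cinner z x + cinner z y"
  using cinner_add_left[of x y z] by (metis cinner_commute complex_cnj_add)

lemma cinner_scaleC_right: "cinner y (a *\<^sub>C x) = cnj a * cinner y x"
  using cinner_scaleC_left[of a x y] by (metis cinner_commute complex_cnj_mult)

lemma cinner_zero [simp]: "cinner 0 y = 0" "cinner y 0 = 0"
  using cinner_scaleC_left[of 0 0 y] cinner_scaleC_right[of y 0 0] by simp_all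

lemma cinner_diff_right: "cinner z (x - y) = cinner z x - cinner z y"
  using cinner_add_right[of z "x - y" y] by simp

lemma cinner_sum_left: "cinner (sum g I) y = (\<Sum>i\<in>I. cinner (g i) y)"
  by (induction I rule: infinite_finite_induct) (auto simp: cinner_add_left)

lemma Re_cinner: "Re (cinner x y) = inner x y"
  by (simp add: inner_ell2_def)

text \<open>Multiplying \<open>x\<close> by the phase \<open>u\<close> makes the complex inner
  product real and nonnegative without changing the norm, so the real Cauchy-Schwarz inequality
  applies.\<close>

lemma cmod_cinner_le: "cmod (cinner x y) \<le> norm x * norm y"
proof (cases "cinner x y = 0")
  case False
  define u where "u = cnj (sgn (cinner x y))"
  have "cmod (cinner x y) = Re (cinner (u *\<^sub>C x) y)"
  proof -
    have "u * cinner x y = complex_of_real (cmod (cinner x y))"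
      using complex_norm_square[of "cinner x y"] False
      by (simp add: u_def sgn_eq field_simps power2_eq_square)
    then show ?thesis by (simp add: cinner_scaleC_left)
  qed
  also have "\<dots> \<le> norm (u *\<^sub>C x) * norm y"
    unfolding Re_cinner by (rule norm_cauchy_schwarz)
  also have "\<dots> = norm x * norm y" using False by (simp add: u_def norm_sgn)
  finally show ?thesis .
qed auto

lemma cinner_self: "cinner x x = complex_of_real ((norm x)\<^sup>2)"
proof (rule complex_eqI)
  show "Re (cinner x x) = Re (complex_of_real ((norm x)\<^sup>2))"
    by (simp add: Re_cinner power2_norm_eq_inner)
  show "Im (cinner x x) = Im (complex_of_real ((norm x)\<^sup>2))"
    using arg_cong[OF cinner_commute[of x x], of Im] by simp
qed

lemma cinner_eqI_right: "(\<And>z. cinner z x = cinner z y) \<Longrightarrow> x = y"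
proof -
  assume "\<And>z. cinner z x = cinner z y"
  then have "cinner (x - y) (x - y) = 0" by (simp add: cinner_diff_right)
  then show "x = y" by (simp add: cinner_self)
qed

lemma bounded_linear_cinner_left: "bounded_linear (\<lambda>x. cinner x y)"
  by (rule bounded_linear_intro[where K = "norm y"])
     (auto simp: cinner_add_left cmod_cinner_le scaleR_ell2_def cinner_scaleC_left scaleR_conv_of_real)

text \<open>The clause \<open>n \<noteq> 0\<close> respects the pinned slot 0, so
  \<open>unit_vec 0\<close> is the zero vector and the facts about unit vectors ask for
  \<open>j \<ge> 1\<close>.\<close>

lift_definition unit_vec :: "nat \<Rightarrow> ell2" is "\<lambda>j n. if n = j \<and> n \<noteq> 0 then 1 else 0"
proof -
  fix j :: nat
  have "summable (\<lambda>n. (cmod (if n = j \<and> n \<noteq> 0 then 1 else 0))\<^sup>2)"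
    by (rule summable_finite[of "{j}"]) auto
  then show "(if 0 = j \<and> (0::nat) \<noteq> 0 then 1 else (0::complex)) = 0 \<and>
    summable (\<lambda>n. (cmod (if n = j \<and> n \<noteq> 0 then 1 else 0))\<^sup>2)" by simp
qed

lemma coord_unit_vec [simp]: "j \<ge> 1 \<Longrightarrow> coord (unit_vec j) n = (if n = j then 1 else 0)"
  by (simp add: unit_vec.rep_eq)

text \<open>The limit is taken coordinatewise. The Cauchy estimate passes to it on finite partial
  sums, uniformly in \<open>N\<close>, and so turns into an estimate of norms.\<close>

lemma Cauchy_ell2_convergent:
  fixes X :: "nat \<Rightarrow> ell2"
  assumes "Cauchy X"
  shows "convergent X"
proof -
  have "\<exists>l. (\<lambda>m. coord (X m) n) \<longlonglongrightarrow> l" for n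
    using Cauchy_convergent[OF bounded_linear.Cauchy[OF bounded_linear_coord assms]]
    by (simp add: convergent_def)
  then obtain l where l: "\<And>n. (\<lambda>m. coord (X m) n) \<longlonglongrightarrow> l n" by metis
  have l0: "l 0 = 0" using LIMSEQ_unique[OF l[of 0]] by simp
  have bound: "(\<Sum>n<N. (cmod (coord (X m) n - l n))\<^sup>2) \<le> e\<^sup>2"
    if M: "\<And>i. i \<ge> M \<Longrightarrow> norm (X m - X i) < e" for M m N e
  proof (rule LIMSEQ_le_const2)
    show "(\<lambda>i. \<Sum>n<N. (cmod (coord (X m) n - coord (X i) n))\<^sup>2)
            \<longlonglongrightarrow> (\<Sum>n<N. (cmod (coord (X m) n - l n))\<^sup>2)"
      by (intro tendsto_intros l)
    have "(\<Sum>n<N. (cmod (coord (X m) n - coord (X i) n))\<^sup>2) \<le> e\<^sup>2" if "i \<ge> M" for i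
      using sum_coord_le_norm[of "{..<N}" "X m - X i"] power_mono[OF less_imp_le[OF M[OF that]], of 2]
      by simp
    then show "\<exists>N'. \<forall>i\<ge>N'. (\<Sum>n<N. (cmod (coord (X m) n - coord (X i) n))\<^sup>2) \<le> e\<^sup>2"
      by blast
  qed
  obtain M1 where M1: "\<And>i. i \<ge> M1 \<Longrightarrow> norm (X M1 - X i) < 1"
    using CauchyD[OF assms zero_less_one] by blast
  have "summable (\<lambda>n. (cmod (coord (X M1) n - l n))\<^sup>2)"
    by (rule summableI_nonneg_bounded[where x = "1\<^sup>2"]) (use bound[OF M1] in auto)
  \<comment> \<open>\<open>l\<close> is \<open>X M1\<close> minus the difference
    \<open>X M1 - l\<close>; both are square summable.\<close>
  from this[THEN square_summable_mult, of "- 1"] summable_coord[of "X M1"]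
  have "summable (\<lambda>n. (cmod (- 1 * (coord (X M1) n - l n) + coord (X M1) n))\<^sup>2)"
    by (rule square_summable_add)
  then have "summable (\<lambda>n. (cmod (l n))\<^sup>2)" by simp
  then have coord_L: "coord (Abs_ell2 l) = l" by (intro Abs_ell2_inverse) (simp add: l0)
  have "X \<longlonglongrightarrow> Abs_ell2 l"
  proof (rule LIMSEQ_I)
    fix e :: real assume "e > 0"
    then obtain M where M: "\<And>m i. m \<ge> M \<Longrightarrow> i \<ge> M \<Longrightarrow> norm (X m - X i) < e / 2"
      using CauchyD[OF assms half_gt_zero[OF \<open>e > 0\<close>]] by blast
    have "norm (X m - Abs_ell2 l) \<le> e / 2" if "m \<ge> M" for m
      by (rule norm_ell2_le) (use \<open>e > 0\<close> bound[OF M[OF that]] in \<open>auto simp: coord_L\<close>)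
    then show "\<exists>no. \<forall>m\<ge>no. norm (X m - Abs_ell2 l) < e"
      using \<open>e > 0\<close> by (intro exI[of _ M]) (fastforce)
  qed
  then show ?thesis by (auto simp: convergent_def)
qed

instance ell2 :: banach
  by standard (rule Cauchy_ell2_convergent)

subsection \<open>Coercive operators\<close>

text \<open>The Lax-Milgram argument: coercivity bounds \<open>S\<close> from below, which gives
  injectivity, and a preimage of \<open>y\<close> is a fixed point of the contraction that sends
  \<open>x\<close> to \<open>x - t *\<^sub>R (S x - y)\<close>. Self-adjointness is avoided because
  the mixed operator of two frames need not have it.\<close>

lemma coercive_bij:
  fixes S :: "'a::{real_inner, complete_space} \<Rightarrow> 'a"
  assumes lin: "bounded_linear S" and "c > 0" and coer: "\<And>x. c * (norm x)\<^sup>2 \<le> inner (S x) x"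
  shows "bij S" "\<And>y. norm (inv S y) \<le> norm y / c" "bounded_linear (inv S)"
proof -
  interpret bounded_linear S by (fact lin)
  have lower: "c * norm x \<le> norm (S x)" for x
  proof (cases "x = 0")
    case False
    have "c * norm x * norm x \<le> norm (S x) * norm x"
      using coer[of x] norm_cauchy_schwarz[of "S x" x] by (simp add: power2_eq_square)
    then show ?thesis using False by simp
  qed simp
  have inj: "inj S"
  proof (rule injI)
    fix x y assume "S x = S y"
    then show "x = y" using lower[of "x - y"] \<open>c > 0\<close> by (simp add: diff mult_le_0_iff)
  qed
  obtain M where M: "M > 0" "\<And>x. norm (S x) \<le> norm x * M" using pos_bounded by blast
  have surj: "\<exists>x. S x = y" for y
  proof -
    \<comment> \<open>Raising the operator bound to at least \<open>c\<close> makes \<open>q\<close>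
      nonnegative. The choice of \<open>t\<close> below minimizes
      \<open>1 - 2 * t * c + t\<^sup>2 * N\<^sup>2\<close>, and \<open>q\<close> is the
      minimum.\<close>
    define N where "N = max M c"
    have N: "N > 0" "c \<le> N" "norm (S x) \<le> N * norm x" for x
      using M(2)[of x] M(1) mult_left_mono[of M N "norm x"] by (auto simp: N_def mult.commute)
    define t where "t = c / N\<^sup>2"
    define q where "q = 1 - c\<^sup>2 / N\<^sup>2"
    have "c\<^sup>2 \<le> N\<^sup>2" using N(2) \<open>c > 0\<close> by (intro power_mono) auto
    then have q: "0 \<le> q" "q < 1" using \<open>c > 0\<close> N(1) by (auto simp: q_def)
    have contr: "norm (z - t *\<^sub>R S z) \<le> sqrt q * norm z" for z
    proof -
      have "(norm (z - t *\<^sub>R S z))\<^sup>2 = (norm z)\<^sup>2 - 2 * t * inner (S z) z + t\<^sup>2 * (norm (S z))\<^sup>2"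
        unfolding power2_norm_eq_inner
        by (simp add: inner_diff_left inner_diff_right inner_commute[of z "S z"] power2_eq_square algebra_simps)
      also have "\<dots> \<le> (norm z)\<^sup>2 - 2 * t * (c * (norm z)\<^sup>2) + t\<^sup>2 * (N * norm z)\<^sup>2"
        using coer[of z] N(3)[of z] \<open>c > 0\<close> N(1)
        by (intro add_mono diff_mono mult_left_mono power_mono) (auto simp: t_def)
      also have "\<dots> = q * (norm z)\<^sup>2"
        using N(1) by (simp add: t_def q_def field_simps power2_eq_square)
      finally have "norm (z - t *\<^sub>R S z) \<le> sqrt (q * (norm z)\<^sup>2)"
        by (rule real_le_rsqrt)
      then show ?thesis by (simp add: real_sqrt_mult)
    qed
    have "\<exists>!x. x - t *\<^sub>R (S x - y) = x"
    proof (rule banach_fix_type[where c = "sqrt q"])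
      show "\<forall>u v. dist (u - t *\<^sub>R (S u - y)) (v - t *\<^sub>R (S v - y)) \<le> sqrt q * dist u v"
      proof (intro allI)
        fix u v
        have "u - t *\<^sub>R (S u - y) - (v - t *\<^sub>R (S v - y)) = (u - v) - t *\<^sub>R S (u - v)"
          by (simp add: diff algebra_simps)
        then show "dist (u - t *\<^sub>R (S u - y)) (v - t *\<^sub>R (S v - y)) \<le> sqrt q * dist u v"
          unfolding dist_norm by (metis contr)
      qed
    qed (use q in auto)
    then obtain x where "x - t *\<^sub>R (S x - y) = x" by blast
    then have "t *\<^sub>R (S x - y) = 0" by (metis add_diff_cancel_left' diff_add_cancel diff_self)
    then show ?thesis using \<open>c > 0\<close> N(1) by (auto simp: t_def)
  qed
  show bij: "bij S" using inj surj by (metis bijI surjI)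
  have Sinv: "S (inv S y) = y" for y using surj by (metis f_inv_into_f rangeI)
  show inv_le: "norm (inv S y) \<le> norm y / c" for y
    using lower[of "inv S y"] \<open>c > 0\<close> by (simp add: Sinv field_simps)
  show "bounded_linear (inv S)"
  proof (rule bounded_linear_intro[where K = "1 / c"])
    show "inv S (x + y) = inv S x + inv S y" for x y
      by (rule injD[OF inj]) (simp add: Sinv add)
    show "inv S (r *\<^sub>R x) = r *\<^sub>R inv S x" for r x
      by (rule injD[OF inj]) (simp add: Sinv scaleR)
    show "norm (inv S x) \<le> norm x * (1 / c)" for x using inv_le[of x] by simp
  qed
qed

subsection \<open>Bessel sequences and frames\<close>

text \<open>The upper frame inequality alone, as an ordinary series that skips slot 0. The
  differences between a frame and its perturbation are only known to satisfy this half.\<close>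

definition bessel :: "(nat \<Rightarrow> ell2) \<Rightarrow> real \<Rightarrow> bool"
  where "bessel f B \<longleftrightarrow> 0 \<le> B \<and>
    (\<forall>g. summable (\<lambda>k. (cmod (cinner g (f (Suc k))))\<^sup>2) \<and>
         (\<Sum>k. (cmod (cinner g (f (Suc k))))\<^sup>2) \<le> B * (norm g)\<^sup>2)"

text \<open>This is the adjoint of the synthesis operator, see \<open>cadjoint_synthesis\<close>.
  \<open>Abs_ell2\<close> has its intended value only for square-summable coefficients, hence the
  Bessel hypothesis wherever the operator is evaluated.\<close>

definition analysis_op :: "(nat \<Rightarrow> ell2) \<Rightarrow> ell2 \<Rightarrow> ell2"
  where "analysis_op f g = Abs_ell2 (\<lambda>n. if n = 0 then 0 else cinner g (f n))"

lemma coord_analysis_op: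
  assumes "bessel f B"
  shows "coord (analysis_op f g) n = (if n = 0 then 0 else cinner g (f n))"
proof -
  have "summable (\<lambda>n. (cmod (if n = 0 then 0 else cinner g (f n)))\<^sup>2)"
    using assms by (subst summable_Suc_iff[symmetric]) (simp add: bessel_def)
  then show ?thesis by (simp add: analysis_op_def Abs_ell2_inverse)
qed

lemma norm_analysis_op_sums:
  assumes "bessel f B"
  shows "(\<lambda>k. (cmod (cinner g (f (Suc k))))\<^sup>2) sums (norm (analysis_op f g))\<^sup>2"
  using norm_ell2_sums_Suc[of "analysis_op f g"] by (simp add: coord_analysis_op[OF assms])

lemma norm_analysis_op_le:
  assumes "bessel f B"
  shows "norm (analysis_op f g) \<le> sqrt B * norm g"
proof -
  have "(norm (analysis_op f g))\<^sup>2 \<le> B * (norm g)\<^sup>2"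
    using assms unfolding sums_unique[OF norm_analysis_op_sums[OF assms]] bessel_def by blast
  then have "norm (analysis_op f g) \<le> sqrt (B * (norm g)\<^sup>2)" by (rule real_le_rsqrt)
  then show ?thesis by (simp add: real_sqrt_mult)
qed

lemma besselI:
  assumes "0 \<le> b"
    and "\<And>g. \<exists>s. (\<lambda>k. (cmod (cinner g (f (Suc k))))\<^sup>2) sums s \<and> s \<le> (b * norm g)\<^sup>2"
  shows "bessel f (b\<^sup>2)"
  unfolding bessel_def
proof (intro conjI allI)
  fix g
  obtain s where s: "(\<lambda>k. (cmod (cinner g (f (Suc k))))\<^sup>2) sums s" "s \<le> (b * norm g)\<^sup>2"
    using assms(2) by blast
  from s(1) show "summable (\<lambda>k. (cmod (cinner g (f (Suc k))))\<^sup>2)" by (rule sums_summable)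
  show "(\<Sum>k. (cmod (cinner g (f (Suc k))))\<^sup>2) \<le> b\<^sup>2 * (norm g)\<^sup>2"
    using s(2) unfolding sums_unique[OF s(1)] by (simp add: power_mult_distrib)
qed simp

lemma analysis_op_add:
  assumes "bessel f B"
  shows "analysis_op f (g + h) = analysis_op f g + analysis_op f h"
  by (rule ell2_eqI) (simp add: coord_analysis_op[OF assms] cinner_add_left)

lemma analysis_op_scaleC:
  assumes "bessel f B"
  shows "analysis_op f (a *\<^sub>C g) = a *\<^sub>C analysis_op f g"
  by (rule ell2_eqI) (simp add: coord_analysis_op[OF assms] cinner_scaleC_left)

lemma bounded_linear_analysis_op:
  assumes "bessel f B"
  shows "bounded_linear (analysis_op f)"
  by (rule bounded_linear_intro[where K = "sqrt B"])
     (use norm_analysis_op_le[OF assms]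
      in \<open>simp_all add: analysis_op_add[OF assms] scaleR_ell2_def analysis_op_scaleC[OF assms] mult.commute\<close>)

text \<open>Duality: for the partial sum \<open>x\<close>, \<open>(norm x)\<^sup>2\<close> pairs the
  coefficients with the inner products of \<open>x\<close> and the vectors. Cauchy-Schwarz and the
  Bessel inequality bound its square by \<open>s * (B * (norm x)\<^sup>2)\<close>, and a factor
  \<open>(norm x)\<^sup>2\<close> cancels.\<close>

lemma norm_partial_synthesis_le:
  assumes "bessel f B" "finite F"
  shows "(norm (\<Sum>k\<in>F. a k *\<^sub>C f (Suc k)))\<^sup>2 \<le> B * (\<Sum>k\<in>F. (cmod (a k))\<^sup>2)"
proof -
  define x where "x = (\<Sum>k\<in>F. a k *\<^sub>C f (Suc k))"
  define s where "s = (\<Sum>k\<in>F. (cmod (a k))\<^sup>2)"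
  have "(norm x)\<^sup>2 = cmod (cinner x x)" by (simp only: cinner_self norm_of_real) simp
  also have "cinner x x = (\<Sum>k\<in>F. a k * cinner (f (Suc k)) x)"
    unfolding x_def[THEN arg_cong[of _ _ "\<lambda>z. cinner z x"]] cinner_sum_left cinner_scaleC_left ..
  also have "cmod \<dots> \<le> (\<Sum>k\<in>F. cmod (a k) * cmod (cinner x (f (Suc k))))"
    by (rule order_trans[OF norm_sum])
       (simp add: norm_mult cinner_commute[of "f _" x])
  finally have "((norm x)\<^sup>2)\<^sup>2 \<le> (\<Sum>k\<in>F. cmod (a k) * cmod (cinner x (f (Suc k))))\<^sup>2"
    by (intro power_mono) auto
  also have "\<dots> \<le> s * (\<Sum>k\<in>F. (cmod (cinner x (f (Suc k))))\<^sup>2)"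
    unfolding s_def by (rule Cauchy_Schwarz_ineq_sum)
  also have "\<dots> \<le> s * (B * (norm x)\<^sup>2)"
  proof (rule mult_left_mono)
    show "(\<Sum>k\<in>F. (cmod (cinner x (f (Suc k))))\<^sup>2) \<le> B * (norm x)\<^sup>2"
      using assms sum_le_suminf[of "\<lambda>k. (cmod (cinner x (f (Suc k))))\<^sup>2" F]
      unfolding bessel_def by (meson order_trans zero_le_power2)
  qed (simp add: s_def sum_nonneg)
  finally have "(norm x)\<^sup>2 * (norm x)\<^sup>2 \<le> (B * s) * (norm x)\<^sup>2"
    by (simp add: power2_eq_square mult_ac)
  moreover have "0 \<le> B * s" using assms by (simp add: s_def sum_nonneg bessel_def)
  ultimately have "(norm x)\<^sup>2 \<le> B * s"
    by (cases "x = 0") (auto intro: mult_right_le_imp_le[of _ "(norm x)\<^sup>2"] simp del: mult_le_cancel_right)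
  then show ?thesis by (simp add: x_def s_def)
qed

lemma summable_synthesis:
  assumes "bessel f B"
  shows "summable (\<lambda>k. coord c (Suc k) *\<^sub>C f (Suc k))"
  unfolding summable_Cauchy
proof (intro allI impI)
  fix e :: real assume "e > 0"
  have B: "0 \<le> B" using assms by (simp add: bessel_def)
  have "summable (\<lambda>k. (cmod (coord c (Suc k)))\<^sup>2)"
    using norm_ell2_sums_Suc sums_summable by blast
  \<comment> \<open>Dividing by \<open>B + 1\<close> covers the case \<open>B = 0\<close> and yields
    the strict inequality at the end.\<close>
  moreover have "0 < e\<^sup>2 / (B + 1)" using \<open>e > 0\<close> B by simp
  ultimately obtain N where
    N: "\<And>m n. m \<ge> N \<Longrightarrow> norm (\<Sum>k\<in>{m..<n}. (cmod (coord c (Suc k)))\<^sup>2) < e\<^sup>2 / (B + 1)"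
    unfolding summable_Cauchy by blast
  show "\<exists>N. \<forall>m\<ge>N. \<forall>n. norm (\<Sum>k\<in>{m..<n}. coord c (Suc k) *\<^sub>C f (Suc k)) < e"
  proof (intro exI allI impI)
    fix m n assume "m \<ge> N"
    have "(norm (\<Sum>k\<in>{m..<n}. coord c (Suc k) *\<^sub>C f (Suc k)))\<^sup>2
        \<le> B * (\<Sum>k\<in>{m..<n}. (cmod (coord c (Suc k)))\<^sup>2)"
      by (rule norm_partial_synthesis_le[OF assms]) simp
    also have "\<dots> \<le> B * (e\<^sup>2 / (B + 1))"
      using N[OF \<open>m \<ge> N\<close>, of n] B by (intro mult_left_mono) auto
    also have "\<dots> < e\<^sup>2" using \<open>e > 0\<close> B by (simp add: field_simps)
    finally show "norm (\<Sum>k\<in>{m..<n}. coord c (Suc k) *\<^sub>C f (Suc k)) < e"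
      using \<open>e > 0\<close> by (simp add: power_less_imp_less_base)
  qed
qed

section \<open>The synthesis operator and its adjoint\<close>

lemma synthesis_sums:
  assumes "bessel f B"
  shows "(\<lambda>k. coord c (Suc k) *\<^sub>C f (Suc k)) sums synthesis f c"
  unfolding synthesis_def by (rule summable_sums[OF summable_synthesis[OF assms]])

lemma norm_synthesis_le:
  assumes "bessel f B"
  shows "norm (synthesis f c) \<le> sqrt B * norm c"
proof -
  have B: "0 \<le> B" using assms by (simp add: bessel_def)
  have "(\<lambda>n. (norm (\<Sum>k<n. coord c (Suc k) *\<^sub>C f (Suc k)))\<^sup>2) \<longlonglongrightarrow> (norm (synthesis f c))\<^sup>2"
    using synthesis_sums[OF assms] unfolding sums_def by (intro tendsto_intros)
  moreover have "(\<lambda>n. B * (\<Sum>k<n. (cmod (coord c (Suc k)))\<^sup>2)) \<longlonglongrightarrow> B * (norm c)\<^sup>2"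
    using norm_ell2_sums_Suc[of c] unfolding sums_def by (intro tendsto_intros)
  ultimately have "(norm (synthesis f c))\<^sup>2 \<le> B * (norm c)\<^sup>2"
    by (rule LIMSEQ_le) (simp add: norm_partial_synthesis_le[OF assms])
  then have "norm (synthesis f c) \<le> sqrt (B * (norm c)\<^sup>2)" by (rule real_le_rsqrt)
  then show ?thesis by (simp add: real_sqrt_mult)
qed

lemma synthesis_add:
  assumes "bessel f B"
  shows "synthesis f (c + d) = synthesis f c + synthesis f d"
  using sums_add[OF synthesis_sums[OF assms, of c] synthesis_sums[OF assms, of d]]
    synthesis_sums[OF assms, of "c + d"]
  by (simp add: scaleC_add_left sums_iff)

lemma synthesis_scaleC:
  assumes "bessel f B"
  shows "synthesis f (a *\<^sub>C c) = a *\<^sub>C synthesis f c"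
  using bounded_linear.sums[OF bounded_linear_scaleC synthesis_sums[OF assms, of c], of a]
    synthesis_sums[OF assms, of "a *\<^sub>C c"]
  by (simp add: sums_iff)

lemma bounded_linear_synthesis:
  assumes "bessel f B"
  shows "bounded_linear (synthesis f)"
  by (rule bounded_linear_intro[where K = "sqrt B"])
     (use norm_synthesis_le[OF assms]
      in \<open>simp_all add: synthesis_add[OF assms] scaleR_ell2_def synthesis_scaleC[OF assms] mult.commute\<close>)

lemma synthesis_adjoint:
  assumes "bessel f B"
  shows "cinner (synthesis f c) g = cinner c (analysis_op f g)"
proof -
  have "(\<lambda>k. coord c (Suc k) * cnj (cinner g (f (Suc k)))) sums cinner (synthesis f c) g"
    using bounded_linear.sums[OF bounded_linear_cinner_left synthesis_sums[OF assms, of c], of g]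
    by (simp add: cinner_scaleC_left flip: cinner_commute)
  moreover have "(\<lambda>k. coord c (Suc k) * cnj (cinner g (f (Suc k)))) sums cinner c (analysis_op f g)"
  proof -
    have "(\<lambda>k. coord c (Suc k) * cnj (coord (analysis_op f g) (Suc k))) sums cinner c (analysis_op f g)"
      using cinner_sums[of c "analysis_op f g"] by (subst sums_Suc_iff) simp
    then show ?thesis by (simp add: coord_analysis_op[OF assms])
  qed
  ultimately show ?thesis by (rule sums_unique2)
qed

text \<open>The definite description is settled by nondegeneracy of the inner product, which leaves
  only one possible adjoint.\<close>

lemma cadjoint_synthesis:
  assumes "bessel f B"
  shows "cadjoint (synthesis f) = analysis_op f"
  unfolding cadjoint_def
proof (rule the_equality)
  show "\<forall>x y. cinner (synthesis f x) y = cinner x (analysis_op f y)"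
    using synthesis_adjoint[OF assms] by blast
  fix W assume "\<forall>x y. cinner (synthesis f x) y = cinner x (W y)"
  then show "W = analysis_op f"
    using synthesis_adjoint[OF assms] by (intro ext cinner_eqI_right) metis
qed

lemma frame_operator_eq:
  "bessel f B \<Longrightarrow> frame_operator f g = synthesis f (analysis_op f g)"
  by (simp add: frame_operator_def cadjoint_synthesis)

lemma bounded_linear_frame_operator:
  assumes "bessel f B"
  shows "bounded_linear (frame_operator f)"
  unfolding frame_operator_def cadjoint_synthesis[OF assms]
  using bounded_linear_compose[OF bounded_linear_synthesis[OF assms] bounded_linear_analysis_op[OF assms]]
  by (simp add: comp_def)

text \<open>Analysis vectors lie in \<open>ell2\<close>, so the triangle inequality there plays the
  part of Minkowski's inequality. With \<open>d\<close> the difference of two sequences, this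
  recovers the second one from \<open>f\<close>.\<close>

lemma bessel_diff:
  assumes f: "bessel f B" and d: "bessel d E"
  shows "bessel (\<lambda>k. f k - d k) ((sqrt B + sqrt E)\<^sup>2)"
    and "analysis_op (\<lambda>k. f k - d k) g = analysis_op f g - analysis_op d g"
    and "synthesis (\<lambda>k. f k - d k) c = synthesis f c - synthesis d c"
proof -
  show *: "bessel (\<lambda>k. f k - d k) ((sqrt B + sqrt E)\<^sup>2)"
  proof (rule besselI)
    fix g
    have "norm (analysis_op f g - analysis_op d g) \<le> (sqrt B + sqrt E) * norm g"
      using norm_triangle_ineq4[of "analysis_op f g" "analysis_op d g"]
        norm_analysis_op_le[OF f, of g] norm_analysis_op_le[OF d, of g]
      by (simp add: algebra_simps)
    then have "(norm (analysis_op f g - analysis_op d g))\<^sup>2 \<le> ((sqrt B + sqrt E) * norm g)\<^sup>2"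
      by (intro power_mono) auto
    then show "\<exists>s. (\<lambda>k. (cmod (cinner g (f (Suc k) - d (Suc k))))\<^sup>2) sums s
        \<and> s \<le> ((sqrt B + sqrt E) * norm g)\<^sup>2"
      using norm_ell2_sums_Suc[of "analysis_op f g - analysis_op d g"]
      by (auto simp: coord_analysis_op[OF f] coord_analysis_op[OF d] cinner_diff_right)
  qed (use f d in \<open>simp add: bessel_def\<close>)
  show "analysis_op (\<lambda>k. f k - d k) g = analysis_op f g - analysis_op d g"
    by (rule ell2_eqI)
       (simp add: coord_analysis_op[OF *] coord_analysis_op[OF f] coord_analysis_op[OF d] cinner_diff_right)
  show "synthesis (\<lambda>k. f k - d k) c = synthesis f c - synthesis d c"
    using sums_diff[OF synthesis_sums[OF f, of c] synthesis_sums[OF d, of c]] synthesis_sums[OF *, of c]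
    by (simp add: scaleC_diff_right sums_iff)
qed

text \<open>For nonnegative terms, unordered and ordinary summation agree; this links the sums in
  \<open>frame_on\<close> with series.\<close>

lemma nonneg_infsum_from_1:
  fixes h :: "nat \<Rightarrow> real"
  assumes "\<And>k. 0 \<le> h k"
  shows "h summable_on {1..} \<longleftrightarrow> summable (\<lambda>k. h (Suc k))"
    and "summable (\<lambda>k. h (Suc k)) \<Longrightarrow> infsum h {1..} = (\<Sum>k. h (Suc k))"
proof -
  have img: "{1..} = range Suc"
    by (auto simp: image_iff) (metis Suc_le_D)
  show summ: "h summable_on {1..} \<longleftrightarrow> summable (\<lambda>k. h (Suc k))"
    unfolding img using assms
    by (simp add: summable_on_reindex comp_def summable_on_UNIV_nonneg_real_iff)
  have eq: "infsum h {1..} = infsum (\<lambda>k. h (Suc k)) UNIV"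
    unfolding img by (simp add: infsum_reindex comp_def)
  show "infsum h {1..} = (\<Sum>k. h (Suc k))" if "summable (\<lambda>k. h (Suc k))"
  proof -
    have "(\<lambda>k. h (Suc k)) summable_on UNIV"
      using that assms by (simp add: summable_on_UNIV_nonneg_real_iff)
    then show ?thesis
      unfolding eq by (metis has_sum_imp_sums has_sum_infsum sums_unique)
  qed
qed

text \<open>Once the frame sums are squared norms in \<open>ell2\<close>, frame bounds can be
  perturbed by the triangle inequality.\<close>

lemma frame_on_iff:
  "frame_on {1..} f A B \<longleftrightarrow>
    0 < A \<and> 0 < B \<and> bessel f B \<and> (\<forall>g. A * (norm g)\<^sup>2 \<le> (norm (analysis_op f g))\<^sup>2)"
proof -
  have "(\<Sum>k. (cmod (cinner g (f (Suc k))))\<^sup>2) = (norm (analysis_op f g))\<^sup>2" if "bessel f B" for g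
    using norm_analysis_op_sums[OF that, of g] by (simp add: sums_iff)
  moreover have "(\<lambda>k. (cmod (cinner g (f k)))\<^sup>2) summable_on {1..} \<and>
      A * (norm g)\<^sup>2 \<le> (\<Sum>\<^sub>\<infinity>k\<in>{1..}. (cmod (cinner g (f k)))\<^sup>2) \<and>
      (\<Sum>\<^sub>\<infinity>k\<in>{1..}. (cmod (cinner g (f k)))\<^sup>2) \<le> B * (norm g)\<^sup>2 \<longleftrightarrow>
    summable (\<lambda>k. (cmod (cinner g (f (Suc k))))\<^sup>2) \<and>
      A * (norm g)\<^sup>2 \<le> (\<Sum>k. (cmod (cinner g (f (Suc k))))\<^sup>2) \<and>
      (\<Sum>k. (cmod (cinner g (f (Suc k))))\<^sup>2) \<le> B * (norm g)\<^sup>2" for g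
    using nonneg_infsum_from_1[of "\<lambda>k. (cmod (cinner g (f k)))\<^sup>2"] by (metis zero_le_power2)
  ultimately show ?thesis
    unfolding frame_on_def bessel_def by (metis less_imp_le)
qed

text \<open>Moving the synthesis operator across the inner product turns the quadratic form of the
  frame operator into the squared norm of \<open>analysis_op f g\<close>.\<close>

lemma frame_operator_coercive:
  assumes "frame_on {1..} f A B"
  shows "A * (norm g)\<^sup>2 \<le> inner (frame_operator f g) g"
proof -
  have f: "bessel f B" and A: "A * (norm g)\<^sup>2 \<le> (norm (analysis_op f g))\<^sup>2"
    using assms unfolding frame_on_iff by auto
  have "inner (frame_operator f g) g = Re (cinner (analysis_op f g) (analysis_op f g))"
    by (simp add: frame_operator_eq[OF f] synthesis_adjoint[OF f] flip: Re_cinner)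
  then show ?thesis using A by (simp only: cinner_self Re_complex_of_real)
qed

text \<open>Test the Bessel inequality on \<open>f k\<close> itself and keep only the term of index
  \<open>k\<close>.\<close>

lemma norm_frame_vector_le:
  assumes "bessel f B" "k \<ge> 1"
  shows "(norm (f k))\<^sup>2 \<le> B"
proof (cases "f k = 0")
  case False
  obtain j where j: "k = Suc j" using assms(2) by (cases k) auto
  have "((norm (f k))\<^sup>2)\<^sup>2 = (cmod (cinner (f k) (f k)))\<^sup>2"
    by (simp only: cinner_self norm_of_real) simp
  also have "\<dots> \<le> (\<Sum>i. (cmod (cinner (f k) (f (Suc i))))\<^sup>2)"
    using assms(1) sum_le_suminf[of "\<lambda>i. (cmod (cinner (f k) (f (Suc i))))\<^sup>2" "{j}"]
    by (simp add: bessel_def j)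
  also have "\<dots> \<le> B * (norm (f k))\<^sup>2" using assms(1) by (simp add: bessel_def)
  finally show ?thesis using False by (simp add: power2_eq_square)
qed (use assms in \<open>simp add: bessel_def\<close>)

text \<open>Any nonzero vector compares the two bounds. This gives \<open>\<epsilon> < B\<close>
  from \<open>\<epsilon> < A\<close>, which the logarithmic gap condition uses.\<close>

lemma frame_bounds_le:
  assumes "frame_on {1..} f A B"
  shows "A \<le> B"
proof -
  have ne: "unit_vec 1 \<noteq> 0"
    using coord_unit_vec[of 1 1] by (metis coord_simps(1) order_refl zero_neq_one)
  have "A * (norm (unit_vec 1))\<^sup>2 \<le> B * (norm (unit_vec 1))\<^sup>2"
    using assms order_trans unfolding frame_on_def by blast
  then show ?thesis using ne by simp
qed

text \<open>Cauchy-Schwarz in each term; the bound is the total of the squared norm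
  estimates.\<close>

lemma bessel_of_square_summable:
  assumes "\<And>k. (norm (d (Suc k)))\<^sup>2 \<le> b k" "b sums s" "0 \<le> s"
  shows "bessel d s"
proof -
  have "bessel d ((sqrt s)\<^sup>2)"
  proof (rule besselI)
    fix g
    have le: "(cmod (cinner g (d (Suc k))))\<^sup>2 \<le> (norm g)\<^sup>2 * b k" for k
    proof -
      have "(cmod (cinner g (d (Suc k))))\<^sup>2 \<le> (norm g * norm (d (Suc k)))\<^sup>2"
        by (intro power_mono cmod_cinner_le) auto
      also have "\<dots> \<le> (norm g)\<^sup>2 * b k"
        using assms(1)[of k] by (simp add: power_mult_distrib mult_left_mono)
      finally show ?thesis .
    qed
    have sb: "(\<lambda>k. (norm g)\<^sup>2 * b k) sums ((norm g)\<^sup>2 * s)" by (rule sums_mult[OF assms(2)])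
    have "summable (\<lambda>k. (cmod (cinner g (d (Suc k))))\<^sup>2)"
      by (rule summable_comparison_test'[OF sums_summable[OF sb], of 0]) (simp add: le)
    then have "(\<lambda>k. (cmod (cinner g (d (Suc k))))\<^sup>2) sums (\<Sum>k. (cmod (cinner g (d (Suc k))))\<^sup>2)"
      by (rule summable_sums)
    moreover from sums_le[OF le this sb]
    have "(\<Sum>k. (cmod (cinner g (d (Suc k))))\<^sup>2) \<le> (sqrt s * norm g)\<^sup>2"
      using assms(3) by (simp add: power_mult_distrib mult.commute)
    ultimately show "\<exists>t. (\<lambda>k. (cmod (cinner g (d (Suc k))))\<^sup>2) sums t \<and> t \<le> (sqrt s * norm g)\<^sup>2"
      by blast
  qed (use assms(3) in simp)
  then show ?thesis using assms(3) by simp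
qed

subsection \<open>Excess and the kernel of the synthesis operator\<close>

text \<open>A homogeneous system with more unknowns than equations. The induction is on the
  equations: \<open>i0\<close> eliminates one unknown \<open>p\<close> from the others.\<close>

lemma exists_nontrivial_solution:
  fixes a :: "'b \<Rightarrow> 'c \<Rightarrow> 'f::field"
  assumes "finite I" "finite J" "card I < card J"
  shows "\<exists>c. (\<exists>j\<in>J. c j \<noteq> 0) \<and> (\<forall>i\<in>I. (\<Sum>j\<in>J. c j * a j i) = 0)"
  using assms
proof (induction I arbitrary: J a rule: finite_induct)
  case empty
  then have "J \<noteq> {}" by auto
  then show ?case by (intro exI[of _ "\<lambda>_. 1"]) auto
next
  case (insert i0 I)
  show ?case
  proof (cases "\<forall>j\<in>J. a j i0 = 0")
    case True
    obtain c where "\<exists>j\<in>J. c j \<noteq> 0" "\<forall>i\<in>I. (\<Sum>j\<in>J. c j * a j i) = 0"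
      using insert.IH[of J a] insert.prems insert.hyps by auto
    with True show ?thesis by (intro exI[of _ c]) auto
  next
    case False
    then obtain p where p: "p \<in> J" "a p i0 \<noteq> 0" by blast
    define K where "K = J - {p}"
    have K: "finite K" "card I < card K" "p \<notin> K"
      using insert.prems insert.hyps p by (auto simp: K_def)
    obtain c where c: "\<exists>j\<in>K. c j \<noteq> 0"
      and c0: "\<And>i. i \<in> I \<Longrightarrow> (\<Sum>j\<in>K. c j * (a j i - a j i0 / a p i0 * a p i)) = 0"
      using insert.IH[of K "\<lambda>j i. a j i - a j i0 / a p i0 * a p i"] K by auto
    \<comment> \<open>The value at \<open>p\<close> is forced by equation \<open>i0\<close>. With it
      every equation for \<open>d\<close> becomes the reduced one for \<open>c\<close>, and the
      reduced coefficients of \<open>i0\<close> itself vanish.\<close>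
    define d where "d = c(p := - (\<Sum>j\<in>K. c j * a j i0) / a p i0)"
    have eq: "(\<Sum>j\<in>J. d j * a j i) = (\<Sum>j\<in>K. c j * (a j i - a j i0 / a p i0 * a p i))" for i
    proof -
      have "(\<Sum>j\<in>J. d j * a j i) = d p * a p i + (\<Sum>j\<in>K. d j * a j i)"
        using p(1) insert.prems(1) unfolding K_def by (rule sum.remove[rotated])
      also have "(\<Sum>j\<in>K. d j * a j i) = (\<Sum>j\<in>K. c j * a j i)"
        using K(3) by (intro sum.cong) (auto simp: d_def)
      also have "d p * a p i = - (\<Sum>j\<in>K. c j * (a j i0 / a p i0 * a p i))"
        by (simp add: d_def sum_distrib_left sum_distrib_right sum_divide_distrib mult.assoc
            sum_negf[symmetric])
      finally show ?thesis by (simp add: right_diff_distrib sum_subtractf)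
    qed
    have "\<exists>j\<in>J. d j \<noteq> 0" using c K(3) by (auto simp: d_def K_def)
    moreover have "\<forall>i\<in>insert i0 I. (\<Sum>j\<in>J. d j * a j i) = 0"
      using c0 p(2) by (auto simp: eq)
    ultimately show ?thesis by blast
  qed
qed

text \<open>
  For finite \<open>J\<close>, this says that restricting the kernel of the synthesis operator to the
  coordinates in \<open>J\<close> gives everything; such \<open>J\<close> are exactly the removable sets.
\<close>

definition kernel_dual :: "(nat \<Rightarrow> ell2) \<Rightarrow> nat set \<Rightarrow> bool"
  where "kernel_dual f J \<longleftrightarrow> (\<exists>w. \<forall>j\<in>J. synthesis f (w j) = 0 \<and>
    (\<forall>i\<in>J. coord (w j) i = (if i = j then 1 else 0)))"

lemma cinner_unit_vec: "j \<ge> 1 \<Longrightarrow> cinner x (unit_vec j) = coord x j"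
proof -
  assume j: "j \<ge> 1"
  have "(\<lambda>n. coord x n * cnj (coord (unit_vec j) n)) = (\<lambda>n. if n = j then coord x n else 0)"
    using j by auto
  with cinner_sums[of x "unit_vec j"] show ?thesis
    by (metis sums_single sums_unique2)
qed

lemma norm_unit_vec: "j \<ge> 1 \<Longrightarrow> norm (unit_vec j) = 1"
  using cinner_self[of "unit_vec j"] cinner_unit_vec[of j "unit_vec j"]
  by (simp add: power2_eq_1_iff flip: of_real_power)
     (metis norm_ge_zero not_one_le_zero order_trans neg_0_le_iff_le)

lemma synthesis_unit_vec:
  assumes "j \<ge> 1"
  shows "synthesis f (unit_vec j) = f j"
proof -
  obtain i where i: "j = Suc i" using assms by (cases j) auto
  have "(\<lambda>k. coord (unit_vec j) (Suc k) *\<^sub>C f (Suc k)) = (\<lambda>k. if k = i then f (Suc k) else 0)"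
    using assms by (auto simp: i)
  then show ?thesis
    unfolding synthesis_def using sums_single[of i "\<lambda>k. f (Suc k)"] by (simp add: sums_iff i)
qed

lemma synthesis_diff:
  "bessel f B \<Longrightarrow> synthesis f (c - d) = synthesis f c - synthesis f d"
  by (rule linear_diff[OF bounded_linear.linear[OF bounded_linear_synthesis]])

lemma synthesis_sum_scaleC:
  assumes "bessel f B"
  shows "synthesis f (\<Sum>j\<in>J. c j *\<^sub>C q j) = (\<Sum>j\<in>J. c j *\<^sub>C synthesis f (q j))"
  using linear_sum[OF bounded_linear.linear[OF bounded_linear_synthesis[OF assms]], of "\<lambda>j. c j *\<^sub>C q j"]
  by (simp add: synthesis_scaleC[OF assms])

lemma analysis_op_sum_scaleC:
  assumes "bessel f B"
  shows "analysis_op f (\<Sum>j\<in>J. c j *\<^sub>C q j) = (\<Sum>j\<in>J. c j *\<^sub>C analysis_op f (q j))"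
  using linear_sum[OF bounded_linear.linear[OF bounded_linear_analysis_op[OF assms]], of "\<lambda>j. c j *\<^sub>C q j"]
  by (simp add: analysis_op_scaleC[OF assms])

text \<open>Zero vectors contribute nothing to the frame sums, so removal can be modelled by zeroing
  and the index set stays \<open>{1..}\<close>.\<close>

lemma frame_on_removed_iff:
  "frame_on ({1..} - J) f A B \<longleftrightarrow> frame_on {1..} (\<lambda>k. if k \<in> J then 0 else f k) A B"
proof -
  have "(\<lambda>k. (cmod (cinner g (f k)))\<^sup>2) summable_on ({1..} - J) \<longleftrightarrow>
      (\<lambda>k. (cmod (cinner g (if k \<in> J then 0 else f k)))\<^sup>2) summable_on {1..}"
    "(\<Sum>\<^sub>\<infinity>k\<in>{1..} - J. (cmod (cinner g (f k)))\<^sup>2) =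
      (\<Sum>\<^sub>\<infinity>k\<in>{1..}. (cmod (cinner g (if k \<in> J then 0 else f k)))\<^sup>2)" for g
    by (rule summable_on_cong_neutral infsum_cong_neutral; auto)+
  then show ?thesis unfolding frame_on_def by simp
qed

text \<open>The remaining frame reproduces each removed \<open>f j\<close> with coefficients that
  vanish on \<open>J\<close>. Subtracting these from the \<open>j\<close>-th unit vector gives a
  kernel vector with the prescribed coordinates on \<open>J\<close>.\<close>

lemma kernel_dual_of_removable:
  assumes f: "bessel f B" and J: "J \<subseteq> {1..}" and fr: "frame_on ({1..} - J) f A' B'"
  shows "kernel_dual f J"
proof -
  define fJ where "fJ k = (if k \<in> J then 0 else f k)" for k
  have fr: "frame_on {1..} fJ A' B'"
    using fr unfolding frame_on_removed_iff fJ_def .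
  then have fJ: "bessel fJ B'" and "A' > 0" by (auto simp only: frame_on_iff)
  have "bij (frame_operator fJ)"
    using coercive_bij(1)[OF bounded_linear_frame_operator[OF fJ] \<open>A' > 0\<close> frame_operator_coercive[OF fr]] .
  then have "\<exists>h. frame_operator fJ h = f j" for j by (metis bij_pointE)
  then obtain h where h: "\<And>j. frame_operator fJ (h j) = f j" by metis
  define w where "w j = unit_vec j - analysis_op fJ (h j)" for j
  have coord0: "coord (analysis_op fJ (h j)) i = 0" if "i \<in> J" for i j
    using that by (simp add: coord_analysis_op[OF fJ] fJ_def)
  have "synthesis f (w j) = 0" if "j \<in> J" for j
  proof -
    have "synthesis f (analysis_op fJ (h j)) = synthesis fJ (analysis_op fJ (h j))"
      unfolding synthesis_def using coord0 by (intro suminf_cong) (simp add: fJ_def)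
    then show ?thesis
      using h[of j] that J
      by (auto simp: w_def synthesis_diff[OF f] synthesis_unit_vec frame_operator_eq[OF fJ])
  qed
  moreover have "coord (w j) i = (if i = j then 1 else 0)" if "i \<in> J" "j \<in> J" for i j
    using that J coord0 by (auto simp: w_def)
  ultimately show ?thesis unfolding kernel_dual_def by blast
qed

text \<open>Analysis vectors are orthogonal to the kernel of the synthesis operator. Pairing with
  \<open>w j\<close> therefore expresses the coordinate at \<open>j\<close> through the coordinates
  outside \<open>J\<close>, so dropping \<open>J\<close> costs only a constant factor in the lower
  bound.\<close>

lemma removable_of_kernel_dual:
  assumes fr: "frame_on {1..} f A B" and J: "J \<subseteq> {1..}" "finite J" and "kernel_dual f J"
  shows "\<exists>A' B'. frame_on ({1..} - J) f A' B'"
proof -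
  obtain w where w0: "\<And>j. j \<in> J \<Longrightarrow> synthesis f (w j) = 0"
    and w: "\<And>i j. i \<in> J \<Longrightarrow> j \<in> J \<Longrightarrow> coord (w j) i = (if i = j then 1 else 0)"
    using assms(4) unfolding kernel_dual_def by metis
  have f: "bessel f B" and AB: "0 < A" "0 < B"
    and A: "\<And>g. A * (norm g)\<^sup>2 \<le> (norm (analysis_op f g))\<^sup>2"
    using fr by (auto simp only: frame_on_iff)
  define fJ where "fJ k = (if k \<in> J then 0 else f k)" for k
  have fJ: "bessel fJ B"
  proof -
    have "bessel fJ ((sqrt B)\<^sup>2)"
    proof (rule besselI)
      fix g
      note S = norm_analysis_op_sums[OF f, of g]
      have le: "(cmod (cinner g (fJ (Suc k))))\<^sup>2 \<le> (cmod (cinner g (f (Suc k))))\<^sup>2" for k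
        by (simp add: fJ_def)
      have "summable (\<lambda>k. (cmod (cinner g (fJ (Suc k))))\<^sup>2)"
        by (rule summable_comparison_test'[OF sums_summable[OF S], of 0]) (simp add: le)
      then have s: "(\<lambda>k. (cmod (cinner g (fJ (Suc k))))\<^sup>2) sums (\<Sum>k. (cmod (cinner g (fJ (Suc k))))\<^sup>2)"
        by (rule summable_sums)
      have "(norm (analysis_op f g))\<^sup>2 \<le> (sqrt B * norm g)\<^sup>2"
        using norm_analysis_op_le[OF f, of g] by (intro power_mono) auto
      with s sums_le[OF le s S]
      show "\<exists>t. (\<lambda>k. (cmod (cinner g (fJ (Suc k))))\<^sup>2) sums t \<and> t \<le> (sqrt B * norm g)\<^sup>2"
        by (meson order_trans)
    qed (use AB in simp)
    then show ?thesis using AB by simp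
  qed
  \<comment> \<open>The 1 pays for the coordinates outside \<open>J\<close>, and
    \<open>norm (w j)\<close> for the one at \<open>j\<close>.\<close>
  define K where "K = 1 + (\<Sum>j\<in>J. norm (w j))"
  have K: "K > 0" by (simp add: K_def sum_nonneg add_pos_nonneg)
  have "norm (analysis_op f g) \<le> K * norm (analysis_op fJ g)" for g
  proof -
    define a where "a = analysis_op f g"
    define a' where "a' = analysis_op fJ g"
    have split: "a = a' + (\<Sum>i\<in>J. coord a i *\<^sub>C unit_vec i)"
    proof (rule ell2_eqI)
      fix n
      have "coord (\<Sum>i\<in>J. coord a i *\<^sub>C unit_vec i) n = (\<Sum>i\<in>J. if n = i then coord a i else 0)"
        using J(1) unfolding coord_sum by (intro sum.cong) auto
      also have "\<dots> = (if n \<in> J then coord a n else 0)" using J(2) by simp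
      finally show "coord a n = coord (a' + (\<Sum>i\<in>J. coord a i *\<^sub>C unit_vec i)) n"
        by (simp add: a_def a'_def coord_analysis_op[OF f] coord_analysis_op[OF fJ] fJ_def)
    qed
    have "cmod (coord a j) \<le> norm (w j) * norm a'" if j: "j \<in> J" for j
    proof -
      \<comment> \<open>This is where \<open>w j\<close> being in the kernel enters, through the
        adjoint relation.\<close>
      have "0 = cinner a (w j)"
        using synthesis_adjoint[OF f, of "w j" g] w0[OF j] cinner_commute[of "w j" a]
        by (simp add: a_def)
      also have "\<dots> = cinner a' (w j) + (\<Sum>i\<in>J. coord a i * cinner (unit_vec i) (w j))"
        by (subst split) (simp add: cinner_add_left cinner_sum_left cinner_scaleC_left)
      also have "(\<Sum>i\<in>J. coord a i * cinner (unit_vec i) (w j)) = (\<Sum>i\<in>J. if i = j then coord a i else 0)"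
        using J(1) w[OF _ j] cinner_unit_vec
        by (intro sum.cong) (auto simp: cinner_commute[of "unit_vec _" "w j"] subset_iff)
      finally have "coord a j = - cinner a' (w j)"
        using J(2) j by (simp add: eq_neg_iff_add_eq_0 add.commute)
      then show ?thesis using cmod_cinner_le[of a' "w j"] by (simp add: mult.commute)
    qed
    then have "norm (\<Sum>i\<in>J. coord a i *\<^sub>C unit_vec i) \<le> (\<Sum>j\<in>J. norm (w j) * norm a')"
      using J(1) by (intro order_trans[OF norm_sum] sum_mono) (auto simp: norm_unit_vec subset_iff)
    then have "norm a \<le> norm a' + (\<Sum>j\<in>J. norm (w j) * norm a')"
      using norm_triangle_ineq[of a' "\<Sum>i\<in>J. coord a i *\<^sub>C unit_vec i"] split by simp
    then show ?thesis
      unfolding a_def a'_def by (simp add: K_def algebra_simps sum_distrib_left)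
  qed
  then have sq: "(norm (analysis_op f g))\<^sup>2 \<le> K\<^sup>2 * (norm (analysis_op fJ g))\<^sup>2" for g
    unfolding power_mult_distrib[symmetric] by (intro power_mono) auto
  have "frame_on {1..} fJ (A / K\<^sup>2) B"
    unfolding frame_on_iff
  proof (intro conjI allI)
    fix g
    show "A / K\<^sup>2 * (norm g)\<^sup>2 \<le> (norm (analysis_op fJ g))\<^sup>2"
      using order_trans[OF A[of g] sq[of g]] K by (simp add: field_simps)
  qed (use AB K fJ in auto)
  then show ?thesis unfolding frame_on_removed_iff fJ_def by blast
qed

text \<open>Gaussian elimination, one pivot coordinate per step.\<close>

lemma kernel_dual_of_independent:
  assumes f: "bessel f B" and J: "finite J" and q: "\<And>j. j \<in> J \<Longrightarrow> synthesis f (q j) = 0"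
    and indep: "\<And>c. (\<Sum>j\<in>J. c j *\<^sub>C q j) = 0 \<Longrightarrow> \<forall>j\<in>J. c j = 0"
    and "m \<le> card J"
  shows "\<exists>I. finite I \<and> I \<subseteq> {1..} \<and> card I = m \<and> kernel_dual f I"
  using \<open>m \<le> card J\<close>
proof (induction m)
  case 0
  show ?case by (intro exI[of _ "{}"]) (auto simp: kernel_dual_def)
next
  case (Suc m)
  then obtain I where I: "finite I" "I \<subseteq> {1..}" "card I = m" "kernel_dual f I"
    by auto
  then obtain w where w0: "\<And>j. j \<in> I \<Longrightarrow> synthesis f (w j) = 0"
    and w: "\<And>i j. i \<in> I \<Longrightarrow> j \<in> I \<Longrightarrow> coord (w j) i = (if i = j then 1 else 0)"
    unfolding kernel_dual_def by metis
  \<comment> \<open>\<open>I\<close> has fewer elements than \<open>J\<close>, so some nontrivial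
    combination of the \<open>q j\<close> vanishes on \<open>I\<close>. Independence keeps it
    nonzero, and any nonzero coordinate is the next pivot \<open>p\<close>.\<close>
  obtain c where c: "\<exists>j\<in>J. c j \<noteq> 0" "\<And>i. i \<in> I \<Longrightarrow> (\<Sum>j\<in>J. c j * coord (q j) i) = 0"
    using exists_nontrivial_solution[OF I(1) J, of "\<lambda>j. coord (q j)"] I(3) Suc.prems by auto
  define u where "u = (\<Sum>j\<in>J. c j *\<^sub>C q j)"
  have "u \<noteq> 0" using indep[of c] c(1) unfolding u_def by blast
  then obtain p where p: "coord u p \<noteq> 0" using ell2_eqI[of u 0] by auto
  have uI: "coord u i = 0" if "i \<in> I" for i using c(2)[OF that] by (simp add: u_def)
  have p1: "p \<ge> 1" "p \<notin> I" using p uI by (auto simp: Suc_le_eq intro!: gr0I)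
  define v where "v = inverse (coord u p) *\<^sub>C u"
  have v: "coord v p = 1" "\<And>i. i \<in> I \<Longrightarrow> coord v i = 0" using p uI by (auto simp: v_def)
  have v0: "synthesis f v = 0"
    using q by (simp add: v_def u_def synthesis_scaleC[OF f] synthesis_sum_scaleC[OF f])
  \<comment> \<open>Multiples of \<open>v\<close> clear the coordinate \<open>p\<close> of the old
    vectors; as \<open>v\<close> vanishes on \<open>I\<close>, their coordinates there
    survive.\<close>
  define w' where "w' j = (if j = p then v else w j - coord (w j) p *\<^sub>C v)" for j
  have "kernel_dual f (insert p I)"
    unfolding kernel_dual_def
  proof (intro exI[of _ w'] ballI conjI)
    fix j assume j: "j \<in> insert p I"
    then show "synthesis f (w' j) = 0"
      using w0 v0 by (auto simp: w'_def synthesis_diff[OF f] synthesis_scaleC[OF f])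
    fix i assume "i \<in> insert p I"
    then show "coord (w' j) i = (if i = j then 1 else 0)"
      using j w v p1(2) by (auto simp: w'_def)
  qed
  then show ?case using I p1 by (intro exI[of _ "insert p I"]) auto
qed

text \<open>
  Both kernels are complements of the range of the analysis operator of \<open>h\<close>, so projecting
  one kernel onto the other along this range preserves linear independence.
\<close>

lemma kernel_dual_transfer:
  assumes f: "bessel f B" and f': "bessel f' B'" and h: "bessel h C"
    and inj: "\<And>x. synthesis f (analysis_op h x) = 0 \<Longrightarrow> x = 0"
    and surj: "\<And>y. \<exists>x. synthesis f' (analysis_op h x) = y"
    and J: "finite J" "kernel_dual f J"
  shows "\<exists>I. finite I \<and> I \<subseteq> {1..} \<and> card I = card J \<and> kernel_dual f' I"
proof -
  obtain w where w0: "\<And>j. j \<in> J \<Longrightarrow> synthesis f (w j) = 0"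
    and w: "\<And>i j. i \<in> J \<Longrightarrow> j \<in> J \<Longrightarrow> coord (w j) i = (if i = j then 1 else 0)"
    using J(2) unfolding kernel_dual_def by metis
  obtain x where x: "\<And>j. synthesis f' (analysis_op h (x j)) = synthesis f' (w j)"
    using choice[of "\<lambda>j x. synthesis f' (analysis_op h x) = synthesis f' (w j)"] surj by blast
  define q where "q j = w j - analysis_op h (x j)" for j
  show ?thesis
  proof (rule kernel_dual_of_independent[OF f' J(1)])
    show "synthesis f' (q j) = 0" for j by (simp add: q_def synthesis_diff[OF f'] x)
    fix c assume "(\<Sum>j\<in>J. c j *\<^sub>C q j) = 0"
    \<comment> \<open>The combination of the \<open>w j\<close> lies in the kernel of
      \<open>synthesis f\<close> and in the range of \<open>analysis_op h\<close>, which meet only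
      in 0 by \<open>inj\<close>.\<close>
    then have eq: "(\<Sum>j\<in>J. c j *\<^sub>C w j) = analysis_op h (\<Sum>j\<in>J. c j *\<^sub>C x j)"
      by (simp add: q_def scaleC_diff_right sum_subtractf analysis_op_sum_scaleC[OF h])
    have "synthesis f (\<Sum>j\<in>J. c j *\<^sub>C w j) = 0"
      using w0 by (simp add: synthesis_sum_scaleC[OF f])
    then have "(\<Sum>j\<in>J. c j *\<^sub>C x j) = 0" unfolding eq by (rule inj)
    then have "(\<Sum>j\<in>J. c j *\<^sub>C w j) = 0"
      using eq linear_0[OF bounded_linear.linear[OF bounded_linear_analysis_op[OF h]]] by simp
    then have z: "coord (\<Sum>j\<in>J. c j *\<^sub>C w j) i = 0" for i by simp
    show "\<forall>j\<in>J. c j = 0"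
    proof
      fix i assume i: "i \<in> J"
      have "coord (\<Sum>j\<in>J. c j *\<^sub>C w j) i = (\<Sum>j\<in>J. if i = j then c j else 0)"
        using w[OF i] unfolding coord_sum by (intro sum.cong) auto
      then show "c i = 0" using z[of i] J(1) i by simp
    qed
  qed simp
qed

text \<open>Not only the suprema but the sets of sizes of removable sets agree:
  \<open>kernel_dual_transfer\<close> runs in both directions through the analysis operator of
  \<open>f\<close>. The condition \<open>r < sqrt A\<close> keeps the mixed operator
  coercive.\<close>

lemma excess_perturbation:
  assumes fr: "frame_on {1..} f A B" and fr': "frame_on {1..} f' A' B'"
    and r: "\<And>c. norm (synthesis f c - synthesis f' c) \<le> r * norm c" "0 \<le> r" "r < sqrt A"
  shows "excess f' = excess f"
proof -
  have f: "bessel f B" and A: "A > 0"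
    and lower: "\<And>g. A * (norm g)\<^sup>2 \<le> (norm (analysis_op f g))\<^sup>2"
    using fr by (auto simp only: frame_on_iff)
  have f': "bessel f' B'" using fr' by (auto simp only: frame_on_iff)
  have lower': "sqrt A * norm g \<le> norm (analysis_op f g)" for g
    using real_sqrt_le_mono[OF lower[of g]] by (simp add: real_sqrt_mult)
  have bij: "bij (\<lambda>x. synthesis f (analysis_op f x))"
    using coercive_bij(1)[OF bounded_linear_frame_operator[OF f] A frame_operator_coercive[OF fr]]
    by (simp add: frame_operator_eq[OF f] cong: bij_betw_cong)
  have bij': "bij (\<lambda>x. synthesis f' (analysis_op f x))"
  proof (rule coercive_bij(1))
    show "bounded_linear (\<lambda>x. synthesis f' (analysis_op f x))"
      by (rule bounded_linear_compose[OF bounded_linear_synthesis[OF f'] bounded_linear_analysis_op[OF f]])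
    \<comment> \<open>With \<open>?a\<close> the analysis vector of \<open>g\<close>, the quadratic
      form is at least \<open>norm ?a * (norm ?a - r * norm g)\<close>, and \<open>norm ?a\<close>
      is at least \<open>sqrt A * norm g\<close>.\<close>
    show "0 < sqrt A * (sqrt A - r)" using A r by simp
    fix g
    let ?a = "analysis_op f g"
    have "inner (synthesis f ?a) g = Re (cinner ?a ?a)"
      by (simp add: synthesis_adjoint[OF f] flip: Re_cinner)
    then have 1: "inner (synthesis f ?a) g = (norm ?a)\<^sup>2" by (simp only: cinner_self Re_complex_of_real)
    have "inner (synthesis f ?a - synthesis f' ?a) g \<le> norm (synthesis f ?a - synthesis f' ?a) * norm g"
      by (rule norm_cauchy_schwarz)
    also have "\<dots> \<le> r * norm ?a * norm g" by (intro mult_right_mono r) simp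
    finally have 2: "(norm ?a)\<^sup>2 - r * norm ?a * norm g \<le> inner (synthesis f' ?a) g"
      using 1 by (simp add: inner_diff_left)
    have "sqrt A * norm g * ((sqrt A - r) * norm g) \<le> norm ?a * (norm ?a - r * norm g)"
      using lower'[of g] A r mult_right_mono[of r "sqrt A" "norm g"] by (intro mult_mono) (auto simp: algebra_simps)
    then show "sqrt A * (sqrt A - r) * (norm g)\<^sup>2 \<le> inner (synthesis f' ?a) g"
      using 2 by (simp add: power2_eq_square algebra_simps del: real_sqrt_mult_self)
  qed
  have inj_surj: "(\<forall>x. F x = 0 \<longrightarrow> x = 0) \<and> (\<forall>y. \<exists>x. F x = y)" if "bij F" "F 0 = 0"
    for F :: "ell2 \<Rightarrow> ell2"
    using that by (metis bij_pointE)
  have zero: "synthesis k (analysis_op f 0) = 0" if "bessel k D" for k D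
    using linear_0[OF bounded_linear.linear[OF bounded_linear_analysis_op[OF f]]]
      linear_0[OF bounded_linear.linear[OF bounded_linear_synthesis[OF that]]] by simp
  note b = inj_surj[OF bij zero[OF f]] inj_surj[OF bij' zero[OF f']]
  \<comment> \<open>Stated for generic \<open>f1\<close> and \<open>f2\<close> to give both
    inclusions: the source needs injectivity and the target surjectivity of its composition with
    \<open>analysis_op f\<close>.\<close>
  have sub: "{enat (card J) | J. finite J \<and> J \<subseteq> {1..} \<and> (\<exists>A B. frame_on ({1..} - J) f1 A B)} \<subseteq>
      {enat (card J) | J. finite J \<and> J \<subseteq> {1..} \<and> (\<exists>A B. frame_on ({1..} - J) f2 A B)}"
    if f1: "bessel f1 B1" and f2: "frame_on {1..} f2 A2 B2"
      and inj: "\<forall>x. synthesis f1 (analysis_op f x) = 0 \<longrightarrow> x = 0"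
      and surj: "\<forall>y. \<exists>x. synthesis f2 (analysis_op f x) = y" for f1 f2 B1 A2 B2
  proof
    fix e assume "e \<in> {enat (card J) | J. finite J \<and> J \<subseteq> {1..} \<and> (\<exists>A B. frame_on ({1..} - J) f1 A B)}"
    then obtain J A3 B3 where J: "e = enat (card J)" "finite J" "J \<subseteq> {1..}" "frame_on ({1..} - J) f1 A3 B3"
      by blast
    have b2: "bessel f2 B2" using f2 by (auto simp only: frame_on_iff)
    obtain I where I: "finite I" "I \<subseteq> {1..}" "card I = card J" "kernel_dual f2 I"
      using kernel_dual_transfer[OF f1 b2 f _ _ J(2) kernel_dual_of_removable[OF f1 J(3,4)]] inj surj
      by blast
    then show "e \<in> {enat (card J) | J. finite J \<and> J \<subseteq> {1..} \<and> (\<exists>A B. frame_on ({1..} - J) f2 A B)}"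
      using removable_of_kernel_dual[OF f2 I(2,1,4)] J(1) by (intro CollectI exI[of _ I]) simp
  qed
  show ?thesis
    unfolding excess_def
    by (intro arg_cong[where f = Sup] subset_antisym
        sub[OF f' fr conjunct1[OF b(2)] conjunct2[OF b(1)]]
        sub[OF f fr' conjunct1[OF b(1)] conjunct2[OF b(2)]])
qed

subsection \<open>Orbits of the weighted shifts\<close>

lemma coord_shift_U_funpow:
  "coord ((shift_U l ^^ a) x) n =
    (if n \<le> a then 0 else complex_of_real (inverse l ^ a) * coord x (n - a))"
proof (induction a arbitrary: n)
  case (Suc a)
  then show ?case by (auto simp: shift_U.rep_eq)
qed simp

lemma coord_shift_T_funpow:
  "coord ((shift_T l ^^ a) x) n =
    (if n = 0 then 0 else complex_of_real (l ^ a) * coord x (n + a))"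
proof (induction a arbitrary: n)
  case (Suc a)
  then show ?case by (auto simp: shift_T.rep_eq)
qed simp

lemma norm_shift_U: "norm (shift_U l x) = \<bar>inverse l\<bar> * norm x"
proof -
  have eq: "coord (shift_U l x) (Suc n) = complex_of_real (inverse l) * coord x n" for n
    by (auto simp: shift_U.rep_eq)
  have "(\<lambda>n. (inverse l)\<^sup>2 * (cmod (coord x n))\<^sup>2) sums (norm (shift_U l x))\<^sup>2"
    using norm_ell2_sums_Suc[of "shift_U l x"] unfolding eq
    by (simp add: norm_mult power_mult_distrib norm_inverse power_inverse)
  from sums_unique2[OF this sums_mult[OF norm_ell2_sums]]
  have "(norm (shift_U l x))\<^sup>2 = (\<bar>inverse l\<bar> * norm x)\<^sup>2"
    by (simp only: power_mult_distrib power2_abs)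
  then show ?thesis by (simp add: power2_eq_iff_nonneg)
qed

lemma norm_shift_U_funpow: "norm ((shift_U l ^^ a) x) = \<bar>inverse l\<bar> ^ a * norm x"
  by (induction a) (simp_all only: funpow.simps comp_apply id_apply norm_shift_U power.simps mult.assoc mult_1)

lemma bounded_linear_shift_T: "bounded_linear (shift_T l)"
proof (rule bounded_linear_intro[where K = "\<bar>l\<bar>"])
  show "shift_T l (x + y) = shift_T l x + shift_T l y" for x y
    by (rule ell2_eqI) (simp add: shift_T.rep_eq algebra_simps)
  show "shift_T l (r *\<^sub>R x) = r *\<^sub>R shift_T l x" for r x
    by (rule ell2_eqI) (simp add: shift_T.rep_eq algebra_simps)
  fix x
  have "(\<lambda>n. (cmod (coord x (Suc (Suc n))))\<^sup>2) sums ((norm x)\<^sup>2 - (cmod (coord x 1))\<^sup>2)"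
    using norm_ell2_sums_Suc[of x] by (subst sums_Suc_iff) simp
  from sums_mult[OF this, of "l\<^sup>2"]
  have "(\<lambda>n. (cmod (coord (shift_T l x) (Suc n)))\<^sup>2) sums (l\<^sup>2 * ((norm x)\<^sup>2 - (cmod (coord x 1))\<^sup>2))"
    by (simp add: shift_T.rep_eq norm_mult power_mult_distrib)
  from sums_unique2[OF norm_ell2_sums_Suc this]
  have "(norm (shift_T l x))\<^sup>2 = l\<^sup>2 * ((norm x)\<^sup>2 - (cmod (coord x 1))\<^sup>2)" .
  also have "\<dots> \<le> l\<^sup>2 * (norm x)\<^sup>2" by (intro mult_left_mono) auto
  also have "\<dots> = (norm x * \<bar>l\<bar>)\<^sup>2" by (simp add: power_mult_distrib)
  finally have "(norm (shift_T l x))\<^sup>2 \<le> (norm x * \<bar>l\<bar>)\<^sup>2" .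
  then show "norm (shift_T l x) \<le> norm x * \<bar>l\<bar>" by (rule power2_le_imp_le) simp
qed

lemma bounded_linear_shift_T_funpow: "bounded_linear (shift_T l ^^ a)"
proof (induction a)
  case 0
  then show ?case using bounded_linear_ident by (simp add: id_def)
next
  case (Suc a)
  then show ?case using bounded_linear_compose[OF bounded_linear_shift_T Suc] by (simp add: comp_def)
qed

section \<open>Supports of shifted blocks\<close>

lemma coord_above_max_index:
  assumes "finitely_supported x" "max_index x < n"
  shows "coord x n = 0"
proof (rule ccontr)
  assume "coord x n \<noteq> 0"
  moreover from this have "x \<noteq> 0" by auto
  ultimately have "n \<le> max_index x"
    using assms(1) by (auto simp: max_index_def finitely_supported_def intro: Max_ge)
  then show False using assms(2) by simp
qed

lemma shift_T_shift_U:
  assumes "a \<le> b" "l \<noteq> 0"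
  shows "(shift_T l ^^ a) ((shift_U l ^^ b) x) = (shift_U l ^^ (b - a)) x"
proof (rule ell2_eqI)
  fix n
  obtain c where b: "b = a + c" using assms(1) le_Suc_ex by blast
  have "l ^ a * inverse l ^ b = inverse l ^ c"
    using assms(2) by (simp add: b power_add field_simps)
  then have "complex_of_real (l ^ a) * complex_of_real (inverse l ^ b) = complex_of_real (inverse l ^ c)"
    by (metis of_real_mult)
  then show "coord ((shift_T l ^^ a) ((shift_U l ^^ b) x)) n = coord ((shift_U l ^^ (b - a)) x) n"
    unfolding coord_shift_T_funpow coord_shift_U_funpow
    by (auto simp: b mult.assoc[symmetric] simp del: of_real_power of_real_mult)
qed

text \<open>The shifted block has no nonzero coordinate beyond \<open>b + max_index x\<close>, and
  \<open>a\<close> backward shifts discard the first \<open>a\<close> coordinates.\<close>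

lemma shift_T_shift_U_eq_0:
  assumes "finitely_supported x" "b + max_index x \<le> a"
  shows "(shift_T l ^^ a) ((shift_U l ^^ b) x) = 0"
proof (rule ell2_eqI)
  fix n
  have "coord x (n + a - b) = 0" if "n \<noteq> 0"
    by (rule coord_above_max_index) (use assms that in auto)
  then show "coord ((shift_T l ^^ a) ((shift_U l ^^ b) x)) n = coord 0 n"
    by (auto simp: coord_shift_T_funpow coord_shift_U_funpow)
qed

text \<open>The supports are disjoint: one ends by index \<open>a + max_index x\<close>, the other
  starts after \<open>b\<close>.\<close>

lemma orthogonal_shift_U:
  assumes "finitely_supported x" "a + max_index x \<le> b"
  shows "orthogonal ((shift_U l ^^ a) x) ((shift_U m ^^ b) y)"
proof -
  have "coord ((shift_U l ^^ a) x) n * cnj (coord ((shift_U m ^^ b) y) n) = 0" for n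
    using coord_above_max_index[OF assms(1), of "n - a"] assms(2)
    by (auto simp: coord_shift_U_funpow)
  then have "cinner ((shift_U l ^^ a) x) ((shift_U m ^^ b) y) = 0"
    unfolding cinner_def by (simp only: suminf_zero)
  then show ?thesis by (simp add: orthogonal_def flip: Re_cinner)
qed

text \<open>The frame property enters only through the uniform bound \<open>B\<close> on the squared
  norms of the vectors.\<close>

lemma shift_orbit_approximation:
  fixes f :: "nat \<Rightarrow> ell2" and \<alpha> :: "nat \<Rightarrow> nat"
  assumes l: "l > 1" and B: "\<And>k. k \<ge> 1 \<Longrightarrow> (norm (f k))\<^sup>2 \<le> B"
    and fin: "\<And>k. k \<ge> 1 \<Longrightarrow> finitely_supported (f k)"
    and mono: "strict_mono_on {1..} \<alpha>"
    and gap: "\<And>k. k \<ge> 1 \<Longrightarrow> \<alpha> k + max_index (f k) \<le> \<alpha> (k + 1)"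
  defines "g \<equiv> \<lambda>n. (shift_U l ^^ \<alpha> (Suc n)) (f (Suc n))"
  shows "summable g"
    and "k \<ge> 1 \<Longrightarrow> (norm (f k - (shift_T l ^^ \<alpha> k) (\<Sum>n. g n)))\<^sup>2
      \<le> B * l\<^sup>2 / (l\<^sup>2 - 1) * inverse l ^ (2 * (\<alpha> (k + 1) - \<alpha> k))"
proof -
  have B0: "0 \<le> B" using B[of 1] order_trans[OF zero_le_power2] by auto
  have less: "\<alpha> i < \<alpha> j" if "1 \<le> i" "i < j" for i j
    using mono that by (auto simp: strict_mono_on_def)
  \<comment> \<open>A strictly increasing sequence of naturals rises by at least 1 per step; all
    geometric decay below comes from this.\<close>
  have grow: "\<alpha> k + n \<le> \<alpha> (k + n)" if "k \<ge> 1" for k n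
  proof (induction n)
    case (Suc n)
    then show ?case using less[of "k + n" "k + Suc n"] that by simp
  qed simp
  have gap': "\<alpha> i + max_index (f i) \<le> \<alpha> j" if "1 \<le> i" "i < j" for i j
    using gap[OF that(1)] grow[of "i + 1" "j - (i + 1)"] that by simp
  have pos: "0 < inverse l" "inverse l < 1" using l by (auto simp: field_simps)
  show summ: "summable g"
  proof (rule summable_comparison_test'[where N = 0])
    show "summable (\<lambda>n. sqrt B * inverse l ^ n)"
      using pos by (intro summable_mult summable_geometric) auto
    fix n
    have "norm (g n) = inverse l ^ \<alpha> (Suc n) * norm (f (Suc n))"
      using pos by (simp add: g_def norm_shift_U_funpow)
    also have "\<dots> \<le> inverse l ^ n * sqrt B"
      using B[of "Suc n"] grow[of 1 n] pos
      by (intro mult_mono power_decreasing) (auto intro: real_le_rsqrt)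
    finally show "norm (g n) \<le> sqrt B * inverse l ^ n" by (simp add: mult.commute)
  qed
  assume k: "k \<ge> 1"
  then obtain k0 where k0: "k = Suc k0" by (cases k) auto
  define T where "T = shift_T l ^^ \<alpha> k"
  \<comment> \<open>\<open>g\<close> is indexed from 0, so \<open>g k0\<close> carries block
    \<open>k\<close> and \<open>h 0\<close> carries block \<open>k + 1\<close>.\<close>
  define h where "h n = T (g (n + k))" for n
  define q where "q = (inverse l)\<^sup>2"
  have q: "0 < q" "q < 1" using pos by (auto simp: q_def power_less_one_iff)
  have Tg0: "T (g n) = 0" if "n < k0" for n
    unfolding T_def g_def by (rule shift_T_shift_U_eq_0) (use fin gap'[of "Suc n" k] that k0 in auto)
  have Tgk: "T (g k0) = f k"
    unfolding T_def g_def using shift_T_shift_U[of "\<alpha> k" "\<alpha> k" l "f k"] l by (simp add: k0)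
  have "(\<lambda>n. T (g n)) sums T (\<Sum>n. g n)"
    unfolding T_def by (rule bounded_linear.sums[OF bounded_linear_shift_T_funpow summable_sums[OF summ]])
  \<comment> \<open>Of the \<open>k\<close> terms split off, those before \<open>k0\<close> vanish
    and the last one is \<open>f k\<close>.\<close>
  then have "h sums (T (\<Sum>n. g n) - (\<Sum>n<k. T (g n)))"
    unfolding h_def by (rule sums_split_initial_segment)
  moreover have "(\<Sum>n<k. T (g n)) = f k" by (simp add: k0 Tg0 Tgk)
  ultimately have "h sums (T (\<Sum>n. g n) - f k)" by simp
  then have lim: "(\<lambda>N. (norm (\<Sum>n<N. h n))\<^sup>2) \<longlonglongrightarrow> (norm (T (\<Sum>n. g n) - f k))\<^sup>2"
    unfolding sums_def by (intro tendsto_intros)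
  have h: "h n = (shift_U l ^^ (\<alpha> (n + k + 1) - \<alpha> k)) (f (n + k + 1))" for n
    unfolding h_def T_def g_def using less[of k "n + k + 1"] k l by (simp add: shift_T_shift_U)
  have orth: "orthogonal (h i) (h j)" if "i < j" for i j
    unfolding h
    by (rule orthogonal_shift_U)
       (use fin gap'[of "i + k + 1" "j + k + 1"] less[of k "i + k + 1"] that k in auto)
  define D where "D = \<alpha> (k + 1) - \<alpha> k"
  \<comment> \<open>Block \<open>k + 1\<close> sits \<open>D\<close> places to the right, and each
    later block gains at least one more place.\<close>
  have hn: "(norm (h n))\<^sup>2 \<le> B * q ^ D * q ^ n" for n
  proof -
    have "(norm (h n))\<^sup>2 = q ^ (\<alpha> (n + k + 1) - \<alpha> k) * (norm (f (n + k + 1)))\<^sup>2"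
      using pos by (simp add: h norm_shift_U_funpow power_mult_distrib q_def power_commutes
          flip: power_mult) (simp add: mult.commute)
    also have "\<dots> \<le> q ^ (D + n) * B"
    proof (intro mult_mono power_decreasing)
      show "D + n \<le> \<alpha> (n + k + 1) - \<alpha> k"
        using grow[of "k + 1" n] less[of k "k + 1"] k by (simp add: D_def add_ac)
    qed (use q B[of "n + k + 1"] B0 in auto)
    finally show ?thesis by (simp add: power_add mult_ac)
  qed
  have "(norm (\<Sum>n<N. h n))\<^sup>2 \<le> B * q ^ D * (1 / (1 - q))" for N
  proof -
    have "(norm (\<Sum>n<N. h n))\<^sup>2 = (\<Sum>n<N. (norm (h n))\<^sup>2)"
      by (rule norm_sum_Pythagorean)
         (auto simp: pairwise_def neq_iff intro: orth orthogonal_commute[THEN iffD1, OF orth])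
    also have "\<dots> \<le> (\<Sum>n<N. B * q ^ D * q ^ n)" by (intro sum_mono hn)
    also have "\<dots> = B * q ^ D * (\<Sum>n<N. q ^ n)" by (simp add: sum_distrib_left)
    also have "\<dots> \<le> B * q ^ D * (1 / (1 - q))"
      using q B0 sum_le_suminf[of "\<lambda>n. q ^ n" "{..<N}"]
      by (intro mult_left_mono) (auto simp: suminf_geometric summable_geometric)
    finally show ?thesis .
  qed
  then have "(norm (T (\<Sum>n. g n) - f k))\<^sup>2 \<le> B * q ^ D * (1 / (1 - q))"
    by (intro LIMSEQ_le_const2[OF lim]) blast
  also have "1 / (1 - q) = l\<^sup>2 / (l\<^sup>2 - 1)"
    using l q by (simp add: q_def field_simps)
  also have "B * q ^ D * (l\<^sup>2 / (l\<^sup>2 - 1)) = B * l\<^sup>2 / (l\<^sup>2 - 1) * inverse l ^ (2 * D)"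
    by (simp add: q_def power_mult)
  finally show "(norm (f k - (shift_T l ^^ \<alpha> k) (\<Sum>n. g n)))\<^sup>2
      \<le> B * l\<^sup>2 / (l\<^sup>2 - 1) * inverse l ^ (2 * (\<alpha> (k + 1) - \<alpha> k))"
    by (simp add: norm_minus_commute T_def D_def)
qed

subsection \<open>Perturbation of frames\<close>

text \<open>The differences form a Bessel sequence with bound \<open>\<epsilon>\<close>, so both its
  analysis and its synthesis operator have norm at most \<open>sqrt \<epsilon>\<close>. Everything
  else is the triangle inequality.\<close>

lemma frame_perturbation:
  fixes f f' :: "nat \<Rightarrow> ell2"
  assumes fr: "frame_on {1..} f A B" and \<epsilon>: "0 < \<epsilon>" "\<epsilon> < A"
    and close: "\<And>k. k \<ge> 1 \<Longrightarrow> (norm (f k - f' k))\<^sup>2 \<le> \<epsilon> * 2 powi (- int k)"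
  shows "frame_on {1..} f' (A * (1 - sqrt (\<epsilon> / A))\<^sup>2) (B * (1 + sqrt (\<epsilon> / B))\<^sup>2)"
    and "excess f' = excess f"
    and "norm (synthesis f c - synthesis f' c) \<le> sqrt \<epsilon> * norm c"
    and "norm (frame_operator f g - frame_operator f' g)
      \<le> sqrt (\<epsilon> * B) * (2 + sqrt (\<epsilon> / B)) * norm g"
proof -
  have f: "bessel f B" and AB: "A > 0" "B > 0"
    and lower: "\<And>g. A * (norm g)\<^sup>2 \<le> (norm (analysis_op f g))\<^sup>2"
    using fr by (auto simp only: frame_on_iff)
  define d where "d k = f k - f' k" for k
  \<comment> \<open>The weights add up to exactly 1, since the index starts at 1; so the Bessel
    bound is \<open>\<epsilon>\<close> itself.\<close>
  have "(\<lambda>k. \<epsilon> * (1 / 2) ^ Suc k) sums (\<epsilon> * 1)"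
    by (intro sums_mult power_half_series)
  moreover have "(norm (d (Suc k)))\<^sup>2 \<le> \<epsilon> * (1 / 2) ^ Suc k" for k
    using close[of "Suc k"] by (simp add: d_def power_int_minus power_int_of_nat power_one_over
        inverse_eq_divide del: of_nat_Suc power_Suc)
  ultimately have d: "bessel d \<epsilon>"
    using bessel_of_square_summable[of d "\<lambda>k. \<epsilon> * (1 / 2) ^ Suc k" \<epsilon>] \<epsilon> by simp
  have f'_eq: "(\<lambda>k. f k - d k) = f'" by (simp add: d_def)
  note f' = bessel_diff(1)[OF f d, unfolded f'_eq]
    and an = bessel_diff(2)[OF f d, unfolded f'_eq]
    and syn = bessel_diff(3)[OF f d, unfolded f'_eq]
  \<comment> \<open>The stated bounds are the squares of \<open>sqrt A - sqrt \<epsilon>\<close> and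
    \<open>sqrt B + sqrt \<epsilon>\<close>, the form that the triangle inequality produces.\<close>
  have loA: "sqrt A * (1 - sqrt (\<epsilon> / A)) = sqrt A - sqrt \<epsilon>"
    using AB by (simp add: real_sqrt_divide field_simps)
  have upB: "sqrt B * (1 + sqrt (\<epsilon> / B)) = sqrt B + sqrt \<epsilon>"
    using AB by (simp add: real_sqrt_divide field_simps)
  have bA: "A * (1 - sqrt (\<epsilon> / A))\<^sup>2 = (sqrt A - sqrt \<epsilon>)\<^sup>2"
    unfolding loA[symmetric] using AB by (simp add: power_mult_distrib)
  have bB: "B * (1 + sqrt (\<epsilon> / B))\<^sup>2 = (sqrt B + sqrt \<epsilon>)\<^sup>2"
    unfolding upB[symmetric] using AB by (simp add: power_mult_distrib)
  show fr': "frame_on {1..} f' (A * (1 - sqrt (\<epsilon> / A))\<^sup>2) (B * (1 + sqrt (\<epsilon> / B))\<^sup>2)"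
    unfolding bA bB frame_on_iff
  proof (intro conjI allI f')
    show "0 < (sqrt A - sqrt \<epsilon>)\<^sup>2" using \<epsilon> by simp
    show "0 < (sqrt B + sqrt \<epsilon>)\<^sup>2" using \<epsilon> AB by (intro zero_less_power add_pos_pos) auto
    fix g
    have "sqrt A * norm g \<le> norm (analysis_op f g)"
      using real_sqrt_le_mono[OF lower[of g]] by (simp add: real_sqrt_mult)
    then have "(sqrt A - sqrt \<epsilon>) * norm g \<le> norm (analysis_op f' g)"
      unfolding an using norm_analysis_op_le[OF d, of g]
        norm_triangle_ineq2[of "analysis_op f g" "analysis_op d g"]
      by (simp add: left_diff_distrib)
    then have "((sqrt A - sqrt \<epsilon>) * norm g)\<^sup>2 \<le> (norm (analysis_op f' g))\<^sup>2"
      using \<epsilon> by (intro power_mono) auto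
    then show "(sqrt A - sqrt \<epsilon>)\<^sup>2 * (norm g)\<^sup>2 \<le> (norm (analysis_op f' g))\<^sup>2"
      by (simp add: power_mult_distrib)
  qed
  show V: "norm (synthesis f c - synthesis f' c) \<le> sqrt \<epsilon> * norm c" for c
    using norm_synthesis_le[OF d, of c] by (simp add: syn)
  show "excess f' = excess f"
    by (rule excess_perturbation[OF fr fr' V]) (use \<epsilon> in auto)
  \<comment> \<open>Telescoping: change the analysis operator first, then the synthesis
    operator.\<close>
  have "frame_operator f g - frame_operator f' g =
      synthesis f (analysis_op d g) + synthesis d (analysis_op f' g)"
    unfolding frame_operator_eq[OF f] frame_operator_eq[OF f'] syn
    by (simp add: an synthesis_diff[OF f])
  then have "norm (frame_operator f g - frame_operator f' g)
      \<le> norm (synthesis f (analysis_op d g)) + norm (synthesis d (analysis_op f' g))"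
    using norm_triangle_ineq by metis
  also have "\<dots> \<le> sqrt B * (sqrt \<epsilon> * norm g) + sqrt \<epsilon> * ((sqrt B + sqrt \<epsilon>) * norm g)"
  proof (rule add_mono)
    show "norm (synthesis f (analysis_op d g)) \<le> sqrt B * (sqrt \<epsilon> * norm g)"
      using AB by (intro order_trans[OF norm_synthesis_le[OF f]] mult_left_mono norm_analysis_op_le[OF d]) auto
    have "norm (analysis_op f' g) \<le> (sqrt B + sqrt \<epsilon>) * norm g"
      using norm_analysis_op_le[OF f', of g] AB \<epsilon> by simp
    then show "norm (synthesis d (analysis_op f' g)) \<le> sqrt \<epsilon> * ((sqrt B + sqrt \<epsilon>) * norm g)"
      using \<epsilon> by (intro order_trans[OF norm_synthesis_le[OF d]] mult_left_mono) auto
  qed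
  also have "\<dots> = sqrt \<epsilon> * (2 * sqrt B + sqrt \<epsilon>) * norm g" by (simp add: algebra_simps)
  also have "sqrt \<epsilon> * (2 * sqrt B + sqrt \<epsilon>) = sqrt (\<epsilon> * B) * (2 + sqrt (\<epsilon> / B))"
    using AB by (simp add: real_sqrt_mult real_sqrt_divide field_simps)
  finally show "norm (frame_operator f g - frame_operator f' g)
      \<le> sqrt (\<epsilon> * B) * (2 + sqrt (\<epsilon> / B)) * norm g" .
qed

text \<open>The resolvent identity: the difference of the inverses is \<open>inv S\<close> applied
  to \<open>S' - S\<close> at \<open>inv S' y\<close>. Coercivity bounds the two inverses by
  \<open>1 / a\<close> and \<open>1 / b\<close>.\<close>

lemma inv_diff_bound:
  fixes S S' :: "'a::{real_inner, complete_space} \<Rightarrow> 'a"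
  assumes S: "bounded_linear S" "0 < a" "\<And>x. a * (norm x)\<^sup>2 \<le> inner (S x) x"
    and S': "bounded_linear S'" "0 < b" "\<And>x. b * (norm x)\<^sup>2 \<le> inner (S' x) x"
    and K: "\<And>x. norm (S x - S' x) \<le> K * norm x" "0 \<le> K"
  shows "norm (inv S y - inv S' y) \<le> K / (a * b) * norm y"
proof -
  note S_bij = coercive_bij[OF S] and S'_bij = coercive_bij[OF S']
  define z where "z = inv S' y"
  have y: "y = S' z" using S'_bij(1) by (simp add: z_def bij_is_surj surj_f_inv_f)
  have "z = inv S (S z)" using S_bij(1) by (simp add: bij_is_inj)
  then have "inv S y - z = inv S (S' z - S z)"
    using linear_diff[OF bounded_linear.linear[OF S_bij(3)]] y by metis
  then have "norm (inv S y - z) \<le> norm (S z - S' z) / a"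
    using S_bij(2)[of "S' z - S z"] by (simp add: norm_minus_commute)
  also have "\<dots> \<le> K * (norm y / b) / a"
    using K(1)[of z] mult_left_mono[OF S'_bij(2)[of y] K(2)] S(2)
    by (intro divide_right_mono) (auto simp: z_def)
  finally show ?thesis by (simp add: z_def mult_ac)
qed

text \<open>Multiplied by \<open>2 * ln l\<close>, the hypothesis is the logarithm of
  \<open>2 ^ k * (B / \<epsilon>) * r \<le> l ^ (2 * D)\<close>, a rearrangement of the
  claim.\<close>

lemma gap_decay:
  fixes l B \<epsilon> :: real and k D :: nat
  assumes "l > 1" "B > 0" "\<epsilon> > 0"
    and D: "(real k * ln 2 + ln (B / \<epsilon>) + ln (l\<^sup>2 / (l\<^sup>2 - 1))) / (2 * ln l) \<le> real D"
  shows "B * l\<^sup>2 / (l\<^sup>2 - 1) * inverse l ^ (2 * D) \<le> \<epsilon> * 2 powi (- int k)"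
proof -
  have l2: "l\<^sup>2 > 1" using assms(1) by (simp add: one_less_power)
  define r where "r = l\<^sup>2 / (l\<^sup>2 - 1)"
  have r: "r > 0" using l2 unfolding r_def by (intro divide_pos_pos) linarith+
  have "real k * ln 2 + ln (B / \<epsilon>) + ln r \<le> real (2 * D) * ln l"
    using D assms(1) by (simp add: r_def field_simps)
  also have "real k * ln 2 + ln (B / \<epsilon>) + ln r = ln (2 ^ k * (B / \<epsilon>) * r)"
    using assms r by (simp add: ln_mult ln_div ln_realpow)
  also have "real (2 * D) * ln l = ln (l ^ (2 * D))" using assms(1) by (simp add: ln_realpow)
  finally have "2 ^ k * (B / \<epsilon>) * r \<le> l ^ (2 * D)"
    using assms r by simp
  then have "B * r * inverse l ^ (2 * D) \<le> \<epsilon> * inverse (2 ^ k)"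
    using assms by (simp add: field_simps)
  then show ?thesis by (simp add: r_def power_int_minus)
qed

text \<open>The logarithmic choice of \<alpha> is not assumed strictly increasing; this follows
  because the second entry of the maximum is positive.\<close>

lemma gap_condition:
  fixes \<alpha> :: "nat \<Rightarrow> nat"
  assumes l: "l > 1" and \<epsilon>: "0 < \<epsilon>" "\<epsilon> < B"
    and gap: "\<And>k. k \<ge> 1 \<Longrightarrow> real (\<alpha> (k + 1)) - real (\<alpha> k) \<ge> max (real (m k))
      ((real k * ln 2 + ln (B / \<epsilon>) + ln (l\<^sup>2 / (l\<^sup>2 - 1))) / (2 * ln l))"
  shows "strict_mono_on {1..} \<alpha>"
    and "k \<ge> 1 \<Longrightarrow> \<alpha> k + m k \<le> \<alpha> (k + 1)"
    and "k \<ge> 1 \<Longrightarrow> B * l\<^sup>2 / (l\<^sup>2 - 1) * inverse l ^ (2 * (\<alpha> (k + 1) - \<alpha> k)) \<le> \<epsilon> * 2 powi (- int k)"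
proof -
  show step: "\<alpha> k + m k \<le> \<alpha> (k + 1)" if "k \<ge> 1" for k
    using gap[OF that] by simp
  show "B * l\<^sup>2 / (l\<^sup>2 - 1) * inverse l ^ (2 * (\<alpha> (k + 1) - \<alpha> k)) \<le> \<epsilon> * 2 powi (- int k)"
    if "k \<ge> 1" for k
    by (rule gap_decay) (use l \<epsilon> gap[OF that] step[OF that] in \<open>auto simp: of_nat_diff\<close>)
  have l2: "1 < l\<^sup>2" using l by (simp add: one_less_power)
  \<comment> \<open>Both \<open>B / \<epsilon>\<close> and
    \<open>l\<^sup>2 / (l\<^sup>2 - 1)\<close> exceed 1, so their logarithms are positive. This
    forces a positive gap even when \<open>m k = 0\<close>.\<close>
  have pos: "0 < (real k * ln 2 + ln (B / \<epsilon>) + ln (l\<^sup>2 / (l\<^sup>2 - 1))) / (2 * ln l)" for k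
    using l l2 \<epsilon> by (intro divide_pos_pos add_nonneg_pos add_nonneg_nonneg) auto
  have less: "\<alpha> k < \<alpha> (Suc k)" if "k \<ge> 1" for k
    using gap[OF that] pos[of k] by simp
  have "\<alpha> i < \<alpha> (i + Suc n)" if "i \<ge> 1" for i n
  proof (induction n)
    case (Suc n)
    then show ?case using less[of "i + Suc n"] by simp
  qed (use less[OF that] in simp)
  then show "strict_mono_on {1..} \<alpha>"
    by (intro strict_mono_onI) (metis atLeast_iff less_imp_Suc_add add_Suc_right)
qed

text \<open>\<open>suminf\<close>, \<open>onorm\<close> and \<open>inv\<close> have their intended
  meaning only alongside summability, bounded linearity and bijectivity, so these appear as
  conclusions too. The series for \<phi> is reindexed to start at 0.\<close>

theorem theorem2p8:
  fixes f :: "nat \<Rightarrow> ell2" and A B lam :: real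
  assumes frame: "frame_on {1..} f A B"
    and fin_supp: "\<And>k. k \<ge> 1 \<Longrightarrow> finitely_supported (f k)"
    and lam: "lam > 1"
  shows "(\<forall>\<alpha> :: nat \<Rightarrow> nat.
      strict_mono_on {1..} \<alpha> \<and> \<alpha> 1 = 0 \<and>
      (\<forall>k\<ge>1. int (\<alpha> (k + 1)) - int (\<alpha> k) \<ge> int (max_index (f k))) \<longrightarrow>
      summable (\<lambda>n. (shift_U lam ^^ \<alpha> (Suc n)) (f (Suc n))) \<and>
      (let \<phi> = (\<Sum>n. (shift_U lam ^^ \<alpha> (Suc n)) (f (Suc n))) in
        \<forall>k\<ge>1. (norm (f k - (shift_T lam ^^ \<alpha> k) \<phi>))\<^sup>2
          \<le> B * lam\<^sup>2 / (lam\<^sup>2 - 1) * lam powi (-2 * (int (\<alpha> (k + 1)) - int (\<alpha> k))))) \<and>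
    (\<forall>\<epsilon> \<in> {0<..<A}. \<forall>\<alpha> :: nat \<Rightarrow> nat.
      \<alpha> 1 = 0 \<and>
      (\<forall>k\<ge>1. real (\<alpha> (k + 1)) - real (\<alpha> k)
        \<ge> max (real (max_index (f k)))
            ((real k * ln 2 + ln (B / \<epsilon>) + ln (lam\<^sup>2 / (lam\<^sup>2 - 1))) / (2 * ln lam))) \<longrightarrow>
      summable (\<lambda>n. (shift_U lam ^^ \<alpha> (Suc n)) (f (Suc n))) \<and>
      (let \<phi> = (\<Sum>n. (shift_U lam ^^ \<alpha> (Suc n)) (f (Suc n)));
           f' = (\<lambda>k. (shift_T lam ^^ \<alpha> k) \<phi>);
           V = synthesis f; V' = synthesis f';
           S = frame_operator f; S' = frame_operator f'
       in
        (\<forall>k\<ge>1. (norm (f k - f' k))\<^sup>2 \<le> \<epsilon> * 2 powi (- int k)) \<and>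
        frame_on {1..} f' (A * (1 - sqrt (\<epsilon> / A))\<^sup>2) (B * (1 + sqrt (\<epsilon> / B))\<^sup>2) \<and>
        excess f' = excess f \<and>
        bounded_linear V \<and> bounded_linear V' \<and>
        onorm (\<lambda>c. V c - V' c) \<le> sqrt \<epsilon> \<and>
        bounded_linear S \<and> bounded_linear S' \<and>
        onorm (\<lambda>g. S g - S' g) \<le> sqrt (\<epsilon> * B) * (2 + sqrt (\<epsilon> / B)) \<and>
        bij S \<and> bij S' \<and> bounded_linear (inv S) \<and> bounded_linear (inv S') \<and>
        onorm (\<lambda>g. inv S g - inv S' g)
          \<le> sqrt (\<epsilon> * B) * (2 + sqrt (\<epsilon> / B)) / (A\<^sup>2 * (1 - sqrt (\<epsilon> / A))\<^sup>2)))"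
\<comment> \<open>Four goals remain, as the \<open>let\<close> blocks stay closed: convergence and
  the estimate for general \<alpha>, then convergence and all conclusions for the logarithmic
  choice.\<close>
proof (intro conjI allI ballI impI, goal_cases)
  case (1 \<alpha>)
  have f: "bessel f B" using frame by (simp only: frame_on_iff)
  have mono: "strict_mono_on {1..} \<alpha>" using 1 by blast
  have step: "\<alpha> k + max_index (f k) \<le> \<alpha> (k + 1)" if "k \<ge> 1" for k
    using 1 that by force
  show ?case
    by (rule shift_orbit_approximation(1)[OF lam norm_frame_vector_le[OF f] fin_supp mono step])
next
  case (2 \<alpha>)
  have f: "bessel f B" using frame by (simp only: frame_on_iff)
  have mono: "strict_mono_on {1..} \<alpha>" using 2 by blast
  have step: "\<alpha> k + max_index (f k) \<le> \<alpha> (k + 1)" if "k \<ge> 1" for k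
    using 2 that by force
  have "lam powi (-2 * (int (\<alpha> (k + 1)) - int (\<alpha> k))) = inverse lam ^ (2 * (\<alpha> (k + 1) - \<alpha> k))"
    if "k \<ge> 1" for k
  proof -
    have "-2 * (int (\<alpha> (k + 1)) - int (\<alpha> k)) = - int (2 * (\<alpha> (k + 1) - \<alpha> k))"
      using step[OF that] by (simp add: of_nat_diff)
    then show ?thesis by (simp only: power_int_minus power_int_of_nat power_inverse)
  qed
  then show ?case
    unfolding Let_def
    using shift_orbit_approximation(2)[OF lam norm_frame_vector_le[OF f] fin_supp mono step]
    by (simp del: One_nat_def)
next
  case (3 \<epsilon> \<alpha>)
  have f: "bessel f B" using frame by (simp only: frame_on_iff)
  have \<epsilon>: "0 < \<epsilon>" "\<epsilon> < B" using 3(1) frame_bounds_le[OF frame] by auto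
  have gap_prem: "real (\<alpha> (k + 1)) - real (\<alpha> k) \<ge> max (real (max_index (f k)))
      ((real k * ln 2 + ln (B / \<epsilon>) + ln (lam\<^sup>2 / (lam\<^sup>2 - 1))) / (2 * ln lam))" if "k \<ge> 1" for k
    using 3(2) that by blast
  note gap = gap_condition[OF lam \<epsilon>, where \<alpha> = \<alpha> and m = "\<lambda>k. max_index (f k)", OF gap_prem]
  show ?case
    by (rule shift_orbit_approximation(1)[OF lam norm_frame_vector_le[OF f] fin_supp gap(1,2)])
next
  case (4 \<epsilon> \<alpha>)
  have f: "bessel f B" and AB: "0 < A" "0 < B" using frame by (simp_all only: frame_on_iff)
  have \<epsilon>: "0 < \<epsilon>" "\<epsilon> < A" "\<epsilon> < B" using 4(1) frame_bounds_le[OF frame] by auto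
  have gap_prem: "real (\<alpha> (k + 1)) - real (\<alpha> k) \<ge> max (real (max_index (f k)))
      ((real k * ln 2 + ln (B / \<epsilon>) + ln (lam\<^sup>2 / (lam\<^sup>2 - 1))) / (2 * ln lam))" if "k \<ge> 1" for k
    using 4(2) that by blast
  note gap = gap_condition[OF lam \<epsilon>(1,3), where \<alpha> = \<alpha> and m = "\<lambda>k. max_index (f k)", OF gap_prem]
  define f' where "f' = (\<lambda>k. (shift_T lam ^^ \<alpha> k) (\<Sum>n. (shift_U lam ^^ \<alpha> (Suc n)) (f (Suc n))))"
  have close: "(norm (f k - f' k))\<^sup>2 \<le> \<epsilon> * 2 powi (- int k)" if "k \<ge> 1" for k
    unfolding f'_def
    by (rule order_trans[OF shift_orbit_approximation(2)[OF lam norm_frame_vector_le[OF f] fin_supp gap(1,2)] gap(3)])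
       (use that in auto)
  note pert = frame_perturbation[OF frame \<epsilon>(1,2) close]
  define A' where "A' = A * (1 - sqrt (\<epsilon> / A))\<^sup>2"
  define B' where "B' = B * (1 + sqrt (\<epsilon> / B))\<^sup>2"
  define K where "K = sqrt (\<epsilon> * B) * (2 + sqrt (\<epsilon> / B))"
  have K: "0 \<le> K" using AB \<epsilon> by (simp add: K_def)
  have fr': "frame_on {1..} f' A' B'" unfolding A'_def B'_def by (rule pert(1))
  then have f': "bessel f' B'" and A': "0 < A'" by (simp_all only: frame_on_iff)
  note S = bounded_linear_frame_operator[OF f] AB(1) frame_operator_coercive[OF frame]
  note S' = bounded_linear_frame_operator[OF f'] A' frame_operator_coercive[OF fr']
  have S_diff: "norm (frame_operator f g - frame_operator f' g) \<le> K * norm g" for g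
    unfolding K_def by (rule pert(4))
  have "onorm (\<lambda>c. synthesis f c - synthesis f' c) \<le> sqrt \<epsilon>"
    using \<epsilon> by (intro onorm_bound pert(3)) auto
  moreover have "onorm (\<lambda>g. frame_operator f g - frame_operator f' g) \<le> K"
    by (intro onorm_bound S_diff K)
  moreover have "onorm (\<lambda>g. inv (frame_operator f) g - inv (frame_operator f') g)
      \<le> K / (A\<^sup>2 * (1 - sqrt (\<epsilon> / A))\<^sup>2)"
  proof (rule onorm_bound)
    \<comment> \<open>The denominator is the product of the coercivity constants of the two frame
      operators.\<close>
    have "A\<^sup>2 * (1 - sqrt (\<epsilon> / A))\<^sup>2 = A * A'" by (simp add: A'_def power2_eq_square)
    then show "norm (inv (frame_operator f) g - inv (frame_operator f') g)
        \<le> K / (A\<^sup>2 * (1 - sqrt (\<epsilon> / A))\<^sup>2) * norm g" for g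
      using inv_diff_bound[OF S S' S_diff K, of g] by simp
  qed (use K in simp)
  ultimately show ?case
    unfolding Let_def f'_def[symmetric] K_def[symmetric]
    using close[unfolded f'_def] pert(1,2) bounded_linear_synthesis[OF f] bounded_linear_synthesis[OF f']
      coercive_bij(1,3)[OF S] coercive_bij(1,3)[OF S'] S(1) S'(1)
    by (intro conjI allI impI)
qed

end
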